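(* Fix a directed graph on $n$ nodes with edge set $E$, a set $\mathcal{B}$ of excited nodes and a set $\mathcal{C}$ of measured nodes with selection matrices $B$ and $C$. For $x\in\mathbb{C}^{|E|}$ with $\det(I-G(x))\neq 0$, let $T(x)=(I-G(x))^{-1}$ and $$K(x)=\big(B^T T^T(x)\otimes C\,T(x)\big)\, I_G .$$ Then exactly one of the two following holds: (i) $\operatorname{rank} K(x)=|E|$ for almost all $x$, and $G$ is generically locally identifiable; (ii) $\operatorname{rank} K(x)=|E|$ for almost no $x$, and $G$ is generically locally non-identifiable. Moreover, for $G=G(x)$, the condition $\operatorname{rank} K(x)=|E|$ is equivalent to the following implication holding for all matrices $\Delta\in\mathbb{C}^{n\times n}$ consistent with the graph: $$C(I-G)^{-1}\Delta (I-G)^{-1}B=0 \;\Rightarrow\; \Delta=0 .$$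
   Context: Setting. A directed graph on nodes $1,\dots,n$ with edge set $E$ is fixed. A matrix $A\in\mathbb{C}^{n\times n}$ is consistent with the graph if $A_{ij}=0$ whenever $j\to i$ is not an edge. Network matrices $G$ are complex $n\times n$ matrices consistent with the graph (a single frequency is considered) for which $I-G$ is invertible. The nodes in $\mathcal{B}$ are excited and those in $\mathcal{C}$ are measured. $B\in\{0,1\}^{n\times|\mathcal{B}|}$ is the full column rank matrix whose columns are the standard basis vectors of the nodes in $\mathcal{B}$. $C\in\{0,1\}^{|\mathcal{C}|\times n}$ is the full row rank matrix whose rows are the transposed standard basis vectors of the nodes in $\mathcal{C}$. Parametrization. Enumerate the edges $1,\dots,|E|$. For $x\in\mathbb{C}^{|E|}$, $G(x)$ is the matrix consistent with the graph whose entry at the position of the $k$-th edge is $x_k$ for each $k$ (so $x\mapsto G(x)$ is a linear bijection onto the matrices consistent with the graph). $\mathbf{e}_k$ denotes the $k$-th standard basis vector of $\mathbb{C}^{|E|}$. $\mathrm{vec}$ stacks the columns of a matrix into a vector, $\otimes$ is the Kronecker product, and $I_G=[\mathrm{vec}(G(\mathbf{e}_1))\ \mathrm{vec}(G(\mathbf{e}_2))\cdots \mathrm{vec}(G(\mathbf{e}_{|E|}))]\in\{0,1\}^{n^2\times|E|}$. Identifiability. The network matrix is locally identifiable at $G$ if each transfer function $G_{ij}$ (with $j\to i$ an edge) is locally identifiable at $G$, i.e. there exists $\epsilon>0$ such that for every network matrix $\tilde G$ consistent with the graph (with $I-\tilde G$ invertible) satisfying $\|\tilde G-G\|<\epsilon$,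 $C(I-\tilde G)^{-1}B=C(I-G)^{-1}B$ implies $\tilde G=G$. Genericity. A property holds for almost all (resp. almost no) $x$ if it holds for all (resp. no) $x\in\mathbb{C}^{|E|}$ with $\det(I-G(x))\ne0$, except possibly those lying on a lower-dimensional set, i.e. a set of dimension lower than that of the ambient space. $G$ is generically locally identifiable if the network matrix is locally identifiable at $G(x)$ for almost all $x$, and generically locally non-identifiable if it is locally identifiable at $G(x)$ for almost no $x$. *)

theory Defs
  imports Complex_Main
    "Jordan_Normal_Form.Gauss_Jordan_Elimination"
    "Jordan_Normal_Form.Determinant"
    "Jordan_Normal_Form.DL_Rank"
begin

subsection \<open>Dimension of subsets of complex affine space\<close>

text \<open>Polynomial functions involving only the coordinates with index in \<open>J\<close>.\<close>

inductive poly_fun :: "nat set \<Rightarrow> (complex vec \<Rightarrow> complex) \<Rightarrow> bool" for J where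
  poly_fun_const: "poly_fun J (\<lambda>x. c)"
| poly_fun_coord: "i \<in> J \<Longrightarrow> poly_fun J (\<lambda>x. x $ i)"
| poly_fun_add: "poly_fun J f \<Longrightarrow> poly_fun J g \<Longrightarrow> poly_fun J (\<lambda>x. f x + g x)"
| poly_fun_mult: "poly_fun J f \<Longrightarrow> poly_fun J g \<Longrightarrow> poly_fun J (\<lambda>x. f x * g x)"

text \<open>The coordinates in \<open>J\<close> are algebraically dependent on \<open>S\<close> if some nonzero polynomial in
  these coordinates vanishes on \<open>S\<close>. Since the field is infinite, a polynomial is nonzero iff
  its function is not identically zero.\<close>

definition alg_dependent_on :: "nat \<Rightarrow> nat set \<Rightarrow> complex vec set \<Rightarrow> bool" where
  "alg_dependent_on m J S \<longleftrightarrow>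
     (\<exists>p. poly_fun J p \<and> (\<exists>x\<in>carrier_vec m. p x \<noteq> 0) \<and> (\<forall>x\<in>S. p x = 0))"

text \<open>The dimension of (the Zariski closure of) a subset of complex \<open>m\<close>-space: the largest number
  of coordinates that are algebraically independent on it. The empty set has dimension \<open>-1\<close>.\<close>

definition alg_dim :: "nat \<Rightarrow> complex vec set \<Rightarrow> int" where
  "alg_dim m S = Max (insert (-1) {int (card J) |J. J \<subseteq> {..<m} \<and> \<not> alg_dependent_on m J S})"

definition lower_dimensional :: "nat \<Rightarrow> complex vec set \<Rightarrow> bool" where
  "lower_dimensional m S \<longleftrightarrow> S \<subseteq> carrier_vec m \<and> alg_dim m S < alg_dim m (carrier_vec m)"

lemma alg_dim_carrier_vec: "alg_dim m (carrier_vec m) = int m"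
proof -
  let ?D = "insert (-1) {int (card J) |J. J \<subseteq> {..<m} \<and> \<not> alg_dependent_on m J (carrier_vec m)}"
  have fin: "finite ?D"
    by (rule finite_subset[of _ "insert (-1) ((\<lambda>J. int (card J)) ` Pow {..<m})"]) auto
  have "\<not> alg_dependent_on m {..<m} (carrier_vec m)"
    unfolding alg_dependent_on_def by blast
  hence "int (card {..<m}) \<in> ?D" by blast
  hence "int m \<in> ?D" by simp
  moreover have "d \<le> int m" if "d \<in> ?D" for d
    using that card_mono[of "{..<m}"] by fastforce
  ultimately show ?thesis unfolding alg_dim_def using fin by (intro Max_eqI) auto
qed

subsection \<open>Vectorization, Kronecker product and norm\<close>

definition vec_of_mat :: "complex mat \<Rightarrow> complex vec" where
  "vec_of_mat A = vec (dim_row A * dim_col A) (\<lambda>k. A $$ (k mod dim_row A, k div dim_row A))"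

definition kronecker :: "complex mat \<Rightarrow> complex mat \<Rightarrow> complex mat" where
  "kronecker A B = mat (dim_row A * dim_row B) (dim_col A * dim_col B)
     (\<lambda>(i, j). A $$ (i div dim_row B, j div dim_col B) * B $$ (i mod dim_row B, j mod dim_col B))"

definition frobenius_norm :: "complex mat \<Rightarrow> real" where
  "frobenius_norm A = sqrt (\<Sum>i<dim_row A. \<Sum>j<dim_col A. (cmod (A $$ (i, j)))\<^sup>2)"

subsection \<open>Network matrices\<close>

text \<open>The nodes are \<open>0, \<dots>, n - 1\<close>, and a pair \<open>(j, i)\<close> in \<open>E\<close> stands for the edge from \<open>j\<close> to \<open>i\<close>.
  Edges and excited and measured nodes are enumerated by distinct lists \<open>es\<close>, \<open>bs\<close>, \<open>cs\<close>.\<close>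

definition consistent :: "nat \<Rightarrow> (nat \<times> nat) set \<Rightarrow> complex mat \<Rightarrow> bool" where
  "consistent n E A \<longleftrightarrow>
     A \<in> carrier_mat n n \<and> (\<forall>i<n. \<forall>j<n. (j, i) \<notin> E \<longrightarrow> A $$ (i, j) = 0)"

definition network_matrix :: "nat \<Rightarrow> (nat \<times> nat) set \<Rightarrow> complex mat \<Rightarrow> bool" where
  "network_matrix n E G \<longleftrightarrow> consistent n E G \<and> invertible_mat (1\<^sub>m n - G)"

definition excitation_mat :: "nat \<Rightarrow> nat list \<Rightarrow> complex mat" where
  "excitation_mat n bs = mat_of_cols n (map (unit_vec n) bs)"

definition measurement_mat :: "nat \<Rightarrow> nat list \<Rightarrow> complex mat" where
  "measurement_mat n cs = mat_of_rows n (map (unit_vec n) cs)"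

text \<open>Used only where \<open>I - G\<close> is invertible, in which case \<open>mat_inverse\<close> is not \<open>None\<close>.\<close>

definition closed_loop :: "nat \<Rightarrow> complex mat \<Rightarrow> complex mat" where
  "closed_loop n G = the (mat_inverse (1\<^sub>m n - G))"

definition locally_identifiable_at ::
    "nat \<Rightarrow> (nat \<times> nat) set \<Rightarrow> nat list \<Rightarrow> nat list \<Rightarrow> complex mat \<Rightarrow> bool" where
  "locally_identifiable_at n E bs cs G \<longleftrightarrow>
     (\<exists>\<epsilon>>0. \<forall>G'. network_matrix n E G' \<longrightarrow> frobenius_norm (G' - G) < \<epsilon> \<longrightarrow>
        measurement_mat n cs * closed_loop n G' * excitation_mat n bs =
        measurement_mat n cs * closed_loop n G * excitation_mat n bs \<longrightarrow> G' = G)"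

subsection \<open>Parametrization\<close>

text \<open>For distinct \<open>es\<close> at most one summand is nonzero, namely the one of the edge from \<open>j\<close> to \<open>i\<close>.\<close>

definition param_mat :: "nat \<Rightarrow> (nat \<times> nat) list \<Rightarrow> complex vec \<Rightarrow> complex mat" where
  "param_mat n es x =
     mat n n (\<lambda>(i, j). \<Sum>k<length es. if es ! k = (j, i) then x $ k else 0)"

definition admissible :: "nat \<Rightarrow> (nat \<times> nat) list \<Rightarrow> complex vec set" where
  "admissible n es = {x \<in> carrier_vec (length es). det (1\<^sub>m n - param_mat n es x) \<noteq> 0}"

definition edge_mat :: "nat \<Rightarrow> (nat \<times> nat) list \<Rightarrow> complex mat" where
  "edge_mat n es = mat_of_cols (n * n)
     (map (\<lambda>k. vec_of_mat (param_mat n es (unit_vec (length es) k))) [0..<length es])"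

definition K_mat ::
    "nat \<Rightarrow> (nat \<times> nat) list \<Rightarrow> nat list \<Rightarrow> nat list \<Rightarrow> complex vec \<Rightarrow> complex mat" where
  "K_mat n es bs cs x =
     (let T = closed_loop n (param_mat n es x) in
       kronecker (transpose_mat (excitation_mat n bs) * transpose_mat T)
         (measurement_mat n cs * T) * edge_mat n es)"

definition mat_rank :: "complex mat \<Rightarrow> nat" where
  "mat_rank A = vec_space.rank (dim_row A) A"

subsection \<open>Genericity\<close>

definition almost_all :: "nat \<Rightarrow> (nat \<times> nat) list \<Rightarrow> (complex vec \<Rightarrow> bool) \<Rightarrow> bool" where
  "almost_all n es P \<longleftrightarrow>
     (\<exists>S. lower_dimensional (length es) S \<and> (\<forall>x\<in>admissible n es - S. P x))"

definition almost_no :: "nat \<Rightarrow> (nat \<times> nat) list \<Rightarrow> (complex vec \<Rightarrow> bool) \<Rightarrow> bool" where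
  "almost_no n es P \<longleftrightarrow>
     (\<exists>S. lower_dimensional (length es) S \<and> (\<forall>x\<in>admissible n es - S. \<not> P x))"

definition generically_locally_identifiable ::
    "nat \<Rightarrow> (nat \<times> nat) set \<Rightarrow> (nat \<times> nat) list \<Rightarrow> nat list \<Rightarrow> nat list \<Rightarrow> bool" where
  "generically_locally_identifiable n E es bs cs \<longleftrightarrow>
     almost_all n es (\<lambda>x. locally_identifiable_at n E bs cs (param_mat n es x))"

definition generically_locally_non_identifiable ::
    "nat \<Rightarrow> (nat \<times> nat) set \<Rightarrow> (nat \<times> nat) list \<Rightarrow> nat list \<Rightarrow> nat list \<Rightarrow> bool" where
  "generically_locally_non_identifiable n E es bs cs \<longleftrightarrow>
     almost_no n es (\<lambda>x. locally_identifiable_at n E bs cs (param_mat n es x))"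

end

theory Submission
  imports Defs
begin

text \<open>The columns of \<open>K\<close> are, up to the factor \<open>det (I - G(x))\<^sup>2\<close>, vectors of polynomials in \<open>x\<close>. Over the
  domain of polynomial functions, they either have a polynomial left inverse up to a nonzero factor
  \<open>g\<close>, or a nonzero polynomial vector \<open>V\<close> lies in the kernel. With \<open>D = G' - G\<close>, the resolvent
  identity gives \<open>T' = T + T D T + T D T' D T\<close>, so the response changes by \<open>C T D T B\<close> up to
  second order in \<open>D\<close>.

  In the first case, where \<open>g\<close> does not vanish, equal responses bound the norm of \<open>D\<close> by a multiple
  of its square, so \<open>D = 0\<close> if it is small. In the second case, the response would be constant along
  the integral curves of \<open>V\<close>; where \<open>V\<close> does not vanish, Euler polygons and compactness replace the
  solution of this differential equation.\<close>

subsection \<open>Polynomial functions\<close>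

text \<open>A first-order response that vanishes at a single point does not disprove local
  identifiability: the map z^2 has derivative 0 at 0, yet only 0 is sent to 0. A kernel vector is
  needed at all points near x at once, varying continuously, so that one can travel along it. This
  is why elimination is done over polynomial functions and not over the numbers at one x: the kernel
  vector it returns is a vector field. A left inverse, by contrast, is used at one point only, where
  dividing by g(x) is harmless. The square of the determinant comes from the two resolvents in each
  entry of K, each being an adjugate divided by the determinant. It is nonzero on the admissible
  set, so it affects neither kernel nor rank. In each case, rank and identifiability share one
  exceptional set, the zero set of g or of one coordinate of V. That the cases exclude each other
  rests on the polynomial functions having no zero divisors and on the determinant being 1 at x =
  0.\<close>

lemma poly_fun_sum:
  assumes "\<And>a. a \<in> A \<Longrightarrow> poly_fun J (f a)"
  shows "poly_fun J (\<lambda>x. \<Sum>a\<in>A. f a x)"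
  using assms
  by (induction A rule: infinite_finite_induct) (auto intro: poly_fun.intros)

lemma poly_fun_prod:
  assumes "\<And>a. a \<in> A \<Longrightarrow> poly_fun J (f a)"
  shows "poly_fun J (\<lambda>x. \<Prod>a\<in>A. f a x)"
  using assms
  by (induction A rule: infinite_finite_induct) (auto intro: poly_fun.intros)

lemma poly_fun_cmult: "poly_fun J f \<Longrightarrow> poly_fun J (\<lambda>x. c * f x)"
  by (rule poly_fun_mult[OF poly_fun_const])

lemma poly_fun_uminus: "poly_fun J f \<Longrightarrow> poly_fun J (\<lambda>x. - f x)"
  using poly_fun_cmult[of J f "-1"] by simp

lemma poly_fun_diff: "poly_fun J f \<Longrightarrow> poly_fun J g \<Longrightarrow> poly_fun J (\<lambda>x. f x - g x)"
  using poly_fun_add[OF _ poly_fun_uminus, of J f g] by simp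

lemmas poly_fun_closure = poly_fun.intros poly_fun_sum poly_fun_prod poly_fun_cmult
  poly_fun_uminus poly_fun_diff

lemma poly_fun_on_line:
  assumes "poly_fun {..<m} f" and "x \<in> carrier_vec m" and "d \<in> carrier_vec m"
  shows "\<exists>P. \<forall>t. f (x + t \<cdot>\<^sub>v d) = poly P t"
  using assms(1)
proof induction
  case (poly_fun_const c)
  show ?case by (rule exI[of _ "[:c:]"]) simp
next
  case (poly_fun_coord i)
  then show ?case using assms(2,3) by (intro exI[of _ "[:x $ i, d $ i:]"]) auto
next
  case (poly_fun_add f g)
  then obtain P Q where "\<forall>t. f (x + t \<cdot>\<^sub>v d) = poly P t" "\<forall>t. g (x + t \<cdot>\<^sub>v d) = poly Q t"
    by blast
  then show ?case by (intro exI[of _ "P + Q"]) simp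
next
  case (poly_fun_mult f g)
  then obtain P Q where "\<forall>t. f (x + t \<cdot>\<^sub>v d) = poly P t" "\<forall>t. g (x + t \<cdot>\<^sub>v d) = poly Q t"
    by blast
  then show ?case by (intro exI[of _ "P * Q"]) simp
qed

text \<open>Polynomial functions have no zero divisors. On the line through \<open>x\<close> and
  \<open>y\<close> both factors restrict to nonzero univariate polynomials, one being nonzero at
  parameter 0 and the other at 1. Their product is a nonzero polynomial, so some parameter is not a
  root.\<close>

lemma poly_fun_mult_nonzero:
  assumes f: "poly_fun {..<m} f" "x \<in> carrier_vec m" "f x \<noteq> 0"
    and g: "poly_fun {..<m} g" "y \<in> carrier_vec m" "g y \<noteq> 0"
  shows "\<exists>z\<in>carrier_vec m. f z * g z \<noteq> 0"
proof -
  have d: "y - x \<in> carrier_vec m" using f g by auto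
  obtain P Q where P: "\<And>t. f (x + t \<cdot>\<^sub>v (y - x)) = poly P t"
    and Q: "\<And>t. g (x + t \<cdot>\<^sub>v (y - x)) = poly Q t"
    using poly_fun_on_line[OF f(1,2) d] poly_fun_on_line[OF g(1) f(2) d] by blast
  have "x + 0 \<cdot>\<^sub>v (y - x) = x" and "x + 1 \<cdot>\<^sub>v (y - x) = y"
    using f(2) g(2) by (auto intro!: eq_vecI)
  hence "poly P 0 \<noteq> 0" and "poly Q 1 \<noteq> 0"
    using P[of 0] Q[of 1] f(3) g(3) by auto
  hence "P * Q \<noteq> 0" by auto
  then obtain t where "poly (P * Q) t \<noteq> 0" using poly_all_0_iff_0 by blast
  hence "f (x + t \<cdot>\<^sub>v (y - x)) * g (x + t \<cdot>\<^sub>v (y - x)) \<noteq> 0" by (simp add: P Q)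
  moreover have "x + t \<cdot>\<^sub>v (y - x) \<in> carrier_vec m" using d f(2) by auto
  ultimately show ?thesis by blast
qed

text \<open>Closed boxes (\<open>\<le> \<delta>\<close>) are used so that limits of points of the
  box satisfy the same estimates later.\<close>

lemma poly_fun_continuous:
  assumes "poly_fun J f" and "\<epsilon> > (0::real)"
  shows "\<exists>\<delta>>0. \<forall>x. (\<forall>i\<in>J. cmod (x $ i - a $ i) \<le> \<delta>) \<longrightarrow> cmod (f x - f a) < \<epsilon>"
  using assms
proof (induction arbitrary: \<epsilon>)
  case (poly_fun_const c)
  then show ?case by (intro exI[of _ 1]) auto
next
  case (poly_fun_coord i)
  have "cmod (x $ i - a $ i) < \<epsilon>" if "\<forall>i\<in>J. cmod (x $ i - a $ i) \<le> \<epsilon> / 2" for x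
    using that[rule_format, OF poly_fun_coord(1)] poly_fun_coord.prems by simp
  then show ?case using poly_fun_coord.prems by (intro exI[of _ "\<epsilon> / 2"]) auto
next
  case (poly_fun_add f g)
  obtain d where d: "d > 0" "\<And>x. \<forall>i\<in>J. cmod (x $ i - a $ i) \<le> d \<Longrightarrow> cmod (f x - f a) < \<epsilon> / 2"
    using poly_fun_add.IH(1)[of "\<epsilon> / 2"] poly_fun_add.prems by auto
  obtain d' where d': "d' > 0" "\<And>x. \<forall>i\<in>J. cmod (x $ i - a $ i) \<le> d' \<Longrightarrow> cmod (g x - g a) < \<epsilon> / 2"
    using poly_fun_add.IH(2)[of "\<epsilon> / 2"] poly_fun_add.prems by auto
  show ?case
  proof (intro exI[of _ "min d d'"] conjI allI impI)
    fix x assume x: "\<forall>i\<in>J. cmod (x $ i - a $ i) \<le> min d d'"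
    have "cmod (f x - f a) < \<epsilon> / 2" by (rule d(2)) (use x in auto)
    moreover have "cmod (g x - g a) < \<epsilon> / 2" by (rule d'(2)) (use x in auto)
    ultimately
    show "cmod (f x + g x - (f a + g a)) < \<epsilon>"
      using norm_triangle_ineq[of "f x - f a" "g x - g a"] by (simp add: algebra_simps)
  qed (use d d' in auto)
next
  case (poly_fun_mult f g)
  define D where "D = 1 + cmod (f a) + cmod (g a)"
  \<comment> \<open>The bound 1 makes the product of the two errors at most \<open>e\<close>. The
    three terms of the expansion below then add up to at most \<open>e * D\<close>, and
    \<open>\<epsilon> / (2 * D)\<close> brings this below \<open>\<epsilon>\<close>.\<close>
  define e where "e = min 1 (\<epsilon> / (2 * D))"
  have pos: "D > 0" by (simp add: D_def add_pos_nonneg)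
  have e: "e > 0" "e \<le> 1" using pos poly_fun_mult.prems by (auto simp: e_def)
  have "e \<le> \<epsilon> / (2 * D)" by (simp add: e_def)
  hence e2: "e * D \<le> \<epsilon> / 2" using pos by (simp add: field_simps)
  obtain d where d: "d > 0" "\<And>x. \<forall>i\<in>J. cmod (x $ i - a $ i) \<le> d \<Longrightarrow> cmod (f x - f a) < e"
    using poly_fun_mult.IH(1)[OF e(1)] by auto
  obtain d' where d': "d' > 0" "\<And>x. \<forall>i\<in>J. cmod (x $ i - a $ i) \<le> d' \<Longrightarrow> cmod (g x - g a) < e"
    using poly_fun_mult.IH(2)[OF e(1)] by auto
  show ?case
  proof (intro exI[of _ "min d d'"] conjI allI impI)
    fix x assume x: "\<forall>i\<in>J. cmod (x $ i - a $ i) \<le> min d d'"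
    have 1: "cmod (f x - f a) \<le> e" by (rule less_imp_le, rule d(2)) (use x in auto)
    have 2: "cmod (g x - g a) \<le> e" by (rule less_imp_le, rule d'(2)) (use x in auto)
    have "f x * g x - f a * g a
        = (f x - f a) * (g x - g a) + f a * (g x - g a) + (f x - f a) * g a"
      by (simp add: algebra_simps)
    hence "cmod (f x * g x - f a * g a) \<le> cmod (f x - f a) * cmod (g x - g a)
        + cmod (f a) * cmod (g x - g a) + cmod (f x - f a) * cmod (g a)"
      using norm_triangle_ineq[of "(f x - f a) * (g x - g a) + f a * (g x - g a)" "(f x - f a) * g a"]
        norm_triangle_ineq[of "(f x - f a) * (g x - g a)" "f a * (g x - g a)"]
      by (simp add: norm_mult)
    also have "\<dots> \<le> e * 1 + cmod (f a) * e + e * cmod (g a)"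
      using 1 2 e by (intro add_mono mult_mono) auto
    also have "\<dots> = e * D" by (simp add: D_def algebra_simps)
    also have "\<dots> < \<epsilon>" using e2 poly_fun_mult.prems by simp
    finally show "cmod (f x * g x - f a * g a) < \<epsilon>" .
  qed (use d d' in auto)
qed

lemma poly_fun_continuous_finite:
  assumes "finite F" and "\<And>f. f \<in> F \<Longrightarrow> poly_fun J f" and "\<epsilon> > (0::real)"
  shows "\<exists>\<delta>>0. \<forall>x. (\<forall>i\<in>J. cmod (x $ i - a $ i) \<le> \<delta>) \<longrightarrow> (\<forall>f\<in>F. cmod (f x - f a) < \<epsilon>)"
  using assms(1,2)
proof induction
  case empty
  show ?case by (rule exI[of _ 1]) simp
next
  case (insert f F)
  obtain d where d: "d > 0"
    "\<And>x. \<forall>i\<in>J. cmod (x $ i - a $ i) \<le> d \<Longrightarrow> \<forall>f\<in>F. cmod (f x - f a) < \<epsilon>"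
    using insert.IH insert.prems by auto
  obtain d' where d': "d' > 0"
    "\<And>x. \<forall>i\<in>J. cmod (x $ i - a $ i) \<le> d' \<Longrightarrow> cmod (f x - f a) < \<epsilon>"
    using poly_fun_continuous[of J f \<epsilon> a] insert.prems assms(3) by auto
  show ?case
  proof (intro exI[of _ "min d d'"] conjI allI impI)
    fix x assume x: "\<forall>i\<in>J. cmod (x $ i - a $ i) \<le> min d d'"
    have "\<forall>f\<in>F. cmod (f x - f a) < \<epsilon>" by (rule d(2)) (use x in auto)
    moreover have "cmod (f x - f a) < \<epsilon>" by (rule d'(2)) (use x in auto)
    ultimately show "\<forall>f\<in>insert f F. cmod (f x - f a) < \<epsilon>" by simp
  qed (use d d' in auto)
qed

subsection \<open>Lower-dimensional sets\<close>

text \<open>A proper subset of \<open>{..<m}\<close> has fewer than \<open>m\<close> elements, so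
  only the full set of coordinates decides whether the dimension drops. From here on,
  lower-dimensional means contained in the zero set of one nonzero polynomial.\<close>

lemma lower_dimensional_iff:
  "lower_dimensional m S \<longleftrightarrow> S \<subseteq> carrier_vec m \<and> alg_dependent_on m {..<m} S"
proof -
  let ?D = "insert (-1) {int (card J) |J. J \<subseteq> {..<m} \<and> \<not> alg_dependent_on m J S}"
  have fin: "finite ?D"
    by (rule finite_subset[of _ "insert (-1) ((\<lambda>J. int (card J)) ` Pow {..<m})"]) auto
  have "alg_dim m S < int m \<longleftrightarrow> (\<forall>d\<in>?D. d < int m)"
    unfolding alg_dim_def using fin by (subst Max_less_iff) auto
  also have "\<dots> \<longleftrightarrow> alg_dependent_on m {..<m} S"
  proof
    assume D: "\<forall>d\<in>?D. d < int m"
    show "alg_dependent_on m {..<m} S"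
    proof (rule ccontr)
      assume "\<not> alg_dependent_on m {..<m} S"
      hence "int (card {..<m}) \<in> ?D" by blast
      with D have "int (card {..<m}) < int m" by blast
      thus False by simp
    qed
  next
    assume dep: "alg_dependent_on m {..<m} S"
    show "\<forall>d\<in>?D. d < int m"
    proof
      fix d assume "d \<in> ?D"
      then consider "d = -1"
        | J where "d = int (card J)" "J \<subseteq> {..<m}" "\<not> alg_dependent_on m J S" by blast
      thus "d < int m"
      proof cases
        case 2
        hence "J \<subset> {..<m}" using dep by auto
        from psubset_card_mono[OF _ this] show ?thesis using 2 by simp
      qed simp
    qed
  qed
  finally show ?thesis by (simp add: lower_dimensional_def alg_dim_carrier_vec)
qed

lemma lower_dimensional_zero_set:
  assumes "poly_fun {..<m} f" and "x \<in> carrier_vec m" and "f x \<noteq> 0"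
  shows "lower_dimensional m {z \<in> carrier_vec m. f z = 0}"
  unfolding lower_dimensional_iff alg_dependent_on_def using assms by blast

lemma lower_dimensional_Un:
  assumes "lower_dimensional m S" and "lower_dimensional m S'"
  shows "lower_dimensional m (S \<union> S')"
proof -
  obtain f x where f: "poly_fun {..<m} f" "x \<in> carrier_vec m" "f x \<noteq> 0" "\<forall>z\<in>S. f z = 0"
    using assms(1) unfolding lower_dimensional_iff alg_dependent_on_def by blast
  obtain g y where g: "poly_fun {..<m} g" "y \<in> carrier_vec m" "g y \<noteq> 0" "\<forall>z\<in>S'. g z = 0"
    using assms(2) unfolding lower_dimensional_iff alg_dependent_on_def by blast
  have "\<exists>z\<in>carrier_vec m. f z * g z \<noteq> 0" by (rule poly_fun_mult_nonzero) (fact f g)+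
  moreover have "poly_fun {..<m} (\<lambda>z. f z * g z)" using f g by (intro poly_fun_mult)
  moreover have "\<forall>z\<in>S \<union> S'. f z * g z = 0" using f g by auto
  ultimately show ?thesis
    using assms unfolding lower_dimensional_iff alg_dependent_on_def
    by (intro conjI exI[of _ "\<lambda>z. f z * g z"]) auto
qed

text \<open>Irreducibility of affine space: a lower-dimensional set cannot cover the points where
  \<open>f\<close> is nonzero. Applied to the determinant, this keeps the two generic cases
  apart.\<close>

lemma lower_dimensional_misses_nonzero:
  assumes "lower_dimensional m S" and "poly_fun {..<m} f" and "x \<in> carrier_vec m" and "f x \<noteq> 0"
  shows "\<exists>z\<in>carrier_vec m - S. f z \<noteq> 0"
proof -
  obtain g y where g: "poly_fun {..<m} g" "y \<in> carrier_vec m" "g y \<noteq> 0" "\<forall>z\<in>S. g z = 0"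
    using assms(1) unfolding lower_dimensional_iff alg_dependent_on_def by blast
  have "\<exists>z\<in>carrier_vec m. f z * g z \<noteq> 0"
    by (rule poly_fun_mult_nonzero) (fact assms g)+
  then obtain z where "z \<in> carrier_vec m" "f z * g z \<noteq> 0" by blast
  thus ?thesis using g(4) by (intro bexI[of _ z]) auto
qed

subsection \<open>Linear algebra over polynomial functions\<close>

text \<open>Fraction-free Gaussian elimination over the ring of polynomial functions: the last column of
  \<open>A\<close> is reduced by the left inverse \<open>u\<close> of the previous columns, and \<open>r\<close> is what remains.\<close>

lemma poly_fun_kernel_or_left_inverse:
  fixes A :: "'i \<Rightarrow> nat \<Rightarrow> complex vec \<Rightarrow> complex"
  assumes "finite I" and "\<And>i j. i \<in> I \<Longrightarrow> j < c \<Longrightarrow> poly_fun {..<m} (A i j)"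
  obtains v where "\<And>j. j < c \<Longrightarrow> poly_fun {..<m} (v j)"
      and "\<exists>j<c. \<exists>x\<in>carrier_vec m. v j x \<noteq> 0"
      and "\<And>x i. x \<in> carrier_vec m \<Longrightarrow> i \<in> I \<Longrightarrow> (\<Sum>j<c. A i j x * v j x) = 0"
  | g u where "poly_fun {..<m} g" and "\<exists>x\<in>carrier_vec m. g x \<noteq> 0"
      and "\<And>k i. k < c \<Longrightarrow> i \<in> I \<Longrightarrow> poly_fun {..<m} (u k i)"
      and "\<And>x k j. x \<in> carrier_vec m \<Longrightarrow> k < c \<Longrightarrow> j < c \<Longrightarrow>
        (\<Sum>i\<in>I. u k i x * A i j x) = (if j = k then g x else 0)"
  using assms(2)
proof (induction c arbitrary: thesis)
  case 0
  \<comment> \<open>With no columns, the empty left inverse works with the factor 1.\<close>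
  show ?case
    by (rule "0.prems"(2)[of "\<lambda>_. 1" "\<lambda>_ _ _. 0"]) (auto intro: poly_fun_const exI[of _ "0\<^sub>v m"])
next
  case (Suc c)
  note PA = Suc.prems(3)
  show ?case
  proof (rule Suc.IH)
    fix v :: "nat \<Rightarrow> complex vec \<Rightarrow> complex"
    assume v: "\<And>j. j < c \<Longrightarrow> poly_fun {..<m} (v j)" "\<exists>j<c. \<exists>x\<in>carrier_vec m. v j x \<noteq> 0"
      "\<And>x i. x \<in> carrier_vec m \<Longrightarrow> i \<in> I \<Longrightarrow> (\<Sum>j<c. A i j x * v j x) = 0"
    let ?v = "v(c := \<lambda>_. 0)"
    show thesis
    proof (rule Suc.prems(1)[of ?v])
      show "\<exists>j<Suc c. \<exists>x\<in>carrier_vec m. ?v j x \<noteq> 0"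
        using v(2) by (metis fun_upd_other less_Suc_eq less_irrefl_nat)
    qed (use v in \<open>auto simp: less_Suc_eq intro: poly_fun_const\<close>)
  next
    fix g :: "complex vec \<Rightarrow> complex" and u :: "nat \<Rightarrow> 'i \<Rightarrow> complex vec \<Rightarrow> complex"
    assume g: "poly_fun {..<m} g" "\<exists>x\<in>carrier_vec m. g x \<noteq> 0"
      and u: "\<And>k i. k < c \<Longrightarrow> i \<in> I \<Longrightarrow> poly_fun {..<m} (u k i)"
        "\<And>x k j. x \<in> carrier_vec m \<Longrightarrow> k < c \<Longrightarrow> j < c \<Longrightarrow>
          (\<Sum>i\<in>I. u k i x * A i j x) = (if j = k then g x else 0)"
    \<comment> \<open>If column \<open>c\<close> is a combination of the earlier columns, then
      \<open>b k\<close> is \<open>g\<close> times its coefficient at column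
      \<open>k\<close>.\<close>
    define b where "b k x = (\<Sum>i\<in>I. u k i x * A i c x)" for k and x :: "complex vec"
    have Pb: "poly_fun {..<m} (b k)" if "k < c" for k
      unfolding b_def using that u PA by (intro poly_fun_closure) auto
    define r where "r i x = g x * A i c x - (\<Sum>k<c. A i k x * b k x)" for i and x :: "complex vec"
    have Pr: "poly_fun {..<m} (r i)" if "i \<in> I" for i
      unfolding r_def using that g Pb PA by (intro poly_fun_closure) auto
    show thesis
    proof (cases "\<exists>i0\<in>I. \<exists>x\<in>carrier_vec m. r i0 x \<noteq> 0")
      case False
      \<comment> \<open>If \<open>r\<close> vanishes, \<open>g\<close> times column \<open>c\<close>
        is the combination of the earlier columns with coefficients \<open>b\<close>. This relation
        is nontrivial because its last coefficient is \<open>g\<close>.\<close>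
      let ?v = "\<lambda>j. if j = c then g else (\<lambda>x. - b j x)"
      show thesis
      proof (rule Suc.prems(1)[of ?v])
        show "poly_fun {..<m} (?v j)" if "j < Suc c" for j
          using that g(1) Pb by (auto intro!: poly_fun_uminus)
        show "\<exists>j<Suc c. \<exists>x\<in>carrier_vec m. ?v j x \<noteq> 0"
          using g(2) by (intro exI[of _ c]) auto
        fix x :: "complex vec" and i assume xi: "x \<in> carrier_vec m" "i \<in> I"
        have "(\<Sum>j<Suc c. A i j x * ?v j x) = (\<Sum>j<c. A i j x * - b j x) + A i c x * g x"
          by simp
        also have "\<dots> = r i x" by (simp add: r_def sum_negf algebra_simps)
        finally show "(\<Sum>j<Suc c. A i j x * ?v j x) = 0" using False xi by auto
      qed
    next
      case True
      then obtain i0 x0 where i0: "i0 \<in> I" "x0 \<in> carrier_vec m" "r i0 x0 \<noteq> 0" by blast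
      \<comment> \<open>As a functional on columns, \<open>w\<close> is \<open>g\<close> times the
        coordinate \<open>i0\<close>, corrected by the rows of \<open>u\<close> so that it kills the
        first \<open>c\<close> columns. On column \<open>c\<close> it takes the value
        \<open>r i0\<close>.\<close>
      define w where
        "w i x = (if i = i0 then g x else 0) - (\<Sum>k<c. A i0 k x * u k i x)"
        for i and x :: "complex vec"
      have Pw: "poly_fun {..<m} (w i)" if "i \<in> I" for i
      proof -
        have "poly_fun {..<m} (\<lambda>x. if i = i0 then g x else 0)"
          using g(1) by (cases "i = i0") (auto intro: poly_fun_const)
        moreover have "poly_fun {..<m} (\<lambda>x. \<Sum>k<c. A i0 k x * u k i x)"
          using that u(1) PA i0 by (intro poly_fun_sum poly_fun_mult) auto
        ultimately show ?thesis unfolding w_def by (rule poly_fun_diff)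
      qed
      have wA: "(\<Sum>i\<in>I. w i x * A i j x)
          = g x * A i0 j x - (\<Sum>k<c. A i0 k x * (\<Sum>i\<in>I. u k i x * A i j x))" for x :: "complex vec" and j
      proof -
        have "(\<Sum>i\<in>I. w i x * A i j x) = (\<Sum>i\<in>I. if i = i0 then g x * A i j x else 0)
            - (\<Sum>i\<in>I. \<Sum>k<c. A i0 k x * (u k i x * A i j x))"
          unfolding w_def sum_subtractf[symmetric]
          by (intro sum.cong) (auto simp: left_diff_distrib sum_distrib_right mult.assoc)
        also have "(\<Sum>i\<in>I. \<Sum>k<c. A i0 k x * (u k i x * A i j x))
            = (\<Sum>k<c. A i0 k x * (\<Sum>i\<in>I. u k i x * A i j x))"
          by (subst sum.swap) (simp add: sum_distrib_left)
        finally show ?thesis using assms(1) i0 by simp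
      qed
      have wA0: "(\<Sum>i\<in>I. w i x * A i j x) = 0" if "x \<in> carrier_vec m" "j < c"
        for x :: "complex vec" and j
      proof -
        have "(\<Sum>k<c. A i0 k x * (\<Sum>i\<in>I. u k i x * A i j x))
            = (\<Sum>k<c. if k = j then A i0 k x * g x else 0)"
          using that by (intro sum.cong) (auto simp: u(2))
        thus ?thesis using that by (simp add: wA)
      qed
      have wAc: "(\<Sum>i\<in>I. w i x * A i c x) = r i0 x" for x :: "complex vec"
        unfolding wA by (simp add: r_def b_def)
      \<comment> \<open>For the new factor \<open>g * r i0\<close>, the row \<open>g * w\<close>
        detects column \<open>c\<close>. The rescaled old rows take the value
        \<open>r i0 * b k\<close> on column \<open>c\<close>, and subtracting \<open>b k * w\<close>
        clears it without disturbing the earlier columns.\<close>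
      define u' where "u' k i x =
        (if k = c then g x * w i x else r i0 x * u k i x - b k x * w i x)"
        for k i and x :: "complex vec"
      show thesis
      proof (rule Suc.prems(2)[of "\<lambda>x. g x * r i0 x" u'])
        show "poly_fun {..<m} (\<lambda>x. g x * r i0 x)" using g Pr i0 by (intro poly_fun_mult)
        obtain y where "y \<in> carrier_vec m" "g y \<noteq> 0" using g(2) by blast
        from poly_fun_mult_nonzero[OF g(1) this Pr[OF i0(1)] i0(2,3)]
        show "\<exists>x\<in>carrier_vec m. g x * r i0 x \<noteq> 0" .
        show "poly_fun {..<m} (u' k i)" if "k < Suc c" "i \<in> I" for k i
          unfolding u'_def using that g Pw Pr[OF i0(1)] Pb u
          by (cases "k = c") (auto intro!: poly_fun_diff poly_fun_mult)
        fix x :: "complex vec" and k j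
        assume x: "x \<in> carrier_vec m" and k: "k < Suc c" and j: "j < Suc c"
        show "(\<Sum>i\<in>I. u' k i x * A i j x) = (if j = k then g x * r i0 x else 0)"
        proof (cases "k = c")
          case True
          have "(\<Sum>i\<in>I. u' k i x * A i j x) = g x * (\<Sum>i\<in>I. w i x * A i j x)"
            by (simp add: u'_def True sum_distrib_left mult.assoc)
          thus ?thesis using x k j True wA0 wAc by (cases "j = c") auto
        next
          case False
          have "(\<Sum>i\<in>I. u' k i x * A i j x)
              = r i0 x * (\<Sum>i\<in>I. u k i x * A i j x) - b k x * (\<Sum>i\<in>I. w i x * A i j x)"
            by (simp add: u'_def False sum_distrib_left sum_subtractf[symmetric] algebra_simps)
          thus ?thesis using x k j False wA0 wAc u(2) by (cases "j = c") (auto simp: b_def)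
        qed
      qed
    qed
  qed (use PA in auto)
qed

section \<open>Determinants and adjugates of matrices of polynomial functions\<close>

lemma poly_fun_det:
  assumes "\<And>x. M x \<in> carrier_mat n n"
    and "\<And>i j. i < n \<Longrightarrow> j < n \<Longrightarrow> poly_fun J (\<lambda>x. M x $$ (i, j))"
  shows "poly_fun J (\<lambda>x. det (M x))"
  unfolding det_def'[OF assms(1)]
  by (intro poly_fun_sum poly_fun_cmult poly_fun_prod assms(2)) (auto simp: permutes_in_image)

text \<open>The inverse has only rational entries. The adjugate replaces it, since its entries are
  signed minors and hence polynomial.\<close>

lemma poly_fun_adj_mat:
  assumes M: "\<And>x. M x \<in> carrier_mat n n"
    and P: "\<And>i j. i < n \<Longrightarrow> j < n \<Longrightarrow> poly_fun J (\<lambda>x. M x $$ (i, j))"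
    and i: "i < n" and j: "j < n"
  shows "poly_fun J (\<lambda>x. adj_mat (M x) $$ (i, j))"
proof -
  have "poly_fun J (\<lambda>x. det (mat_delete (M x) j i))"
  proof (rule poly_fun_det)
    show "mat_delete (M x) j i \<in> carrier_mat (n - 1) (n - 1)" for x
      using M by (rule mat_delete_carrier)
    fix k l assume kl: "k < n - 1" "l < n - 1"
    have "mat_delete (M x) j i $$ (k, l)
        = M x $$ (if k < j then k else Suc k, if l < i then l else Suc l)" for x
      using kl M[of x] by (auto simp: mat_delete_def)
    moreover have "(if k < j then k else Suc k) < n" "(if l < i then l else Suc l) < n"
      using kl by auto
    ultimately show "poly_fun J (\<lambda>x. mat_delete (M x) j i $$ (k, l))" using P by simp
  qed
  moreover have "adj_mat (M x) $$ (i, j) = (-1) ^ (j + i) * det (mat_delete (M x) j i)" for x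
    using i j M[of x] by (simp add: adj_mat_def cofactor_def)
  ultimately show ?thesis by (simp add: poly_fun_cmult)
qed

lemma index_add_add_mat:
  fixes A :: "'a :: ab_semigroup_add mat"
  assumes "A \<in> carrier_mat nr nc" and "B \<in> carrier_mat nr nc" and "C \<in> carrier_mat nr nc"
    and "i < nr" and "j < nc"
  shows "(A + B + C) $$ (i, j) = A $$ (i, j) + B $$ (i, j) + C $$ (i, j)"
  using assms by (auto simp: add.assoc)

subsection \<open>A submultiplicative norm\<close>

text \<open>The entrywise l1 norm: it dominates every entry, and its submultiplicativity needs only
  the triangle inequality. It is compared below with the Frobenius norm, in which identifiability is
  stated.\<close>

definition sum_norm :: "complex mat \<Rightarrow> real" where
  "sum_norm A = (\<Sum>i<dim_row A. \<Sum>j<dim_col A. cmod (A $$ (i, j)))"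

lemma sum_norm_nonneg: "0 \<le> sum_norm A"
  by (simp add: sum_norm_def sum_nonneg)

lemma sum_norm_entry:
  assumes "i < dim_row A" and "j < dim_col A"
  shows "cmod (A $$ (i, j)) \<le> sum_norm A"
proof -
  have "cmod (A $$ (i, j)) \<le> (\<Sum>j<dim_col A. cmod (A $$ (i, j)))"
    using assms by (intro member_le_sum) auto
  also have "\<dots> \<le> sum_norm A"
    unfolding sum_norm_def using assms by (intro member_le_sum) (auto simp: sum_nonneg)
  finally show ?thesis .
qed

lemma sum_norm_add:
  assumes "A \<in> carrier_mat nr nc" and "B \<in> carrier_mat nr nc"
  shows "sum_norm (A + B) \<le> sum_norm A + sum_norm B"
proof -
  have "sum_norm (A + B) = (\<Sum>i<nr. \<Sum>j<nc. cmod (A $$ (i, j) + B $$ (i, j)))"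
    using assms by (simp add: sum_norm_def)
  also have "\<dots> \<le> (\<Sum>i<nr. \<Sum>j<nc. cmod (A $$ (i, j)) + cmod (B $$ (i, j)))"
    by (intro sum_mono norm_triangle_ineq)
  finally show ?thesis using assms by (simp add: sum_norm_def sum.distrib)
qed

lemma sum_norm_mult:
  assumes A: "A \<in> carrier_mat nr n" and B: "B \<in> carrier_mat n nc"
  shows "sum_norm (A * B) \<le> sum_norm A * sum_norm B"
proof -
  have row: "(\<Sum>j<nc. cmod ((A * B) $$ (i, j))) \<le> (\<Sum>k<n. cmod (A $$ (i, k))) * sum_norm B"
    if "i < nr" for i
  proof -
    have "(\<Sum>j<nc. cmod ((A * B) $$ (i, j)))
        \<le> (\<Sum>j<nc. \<Sum>k<n. cmod (A $$ (i, k)) * cmod (B $$ (k, j)))"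
    proof (rule sum_mono)
      fix j assume "j \<in> {..<nc}"
      hence "(A * B) $$ (i, j) = (\<Sum>k<n. A $$ (i, k) * B $$ (k, j))"
        using A B that by (simp add: scalar_prod_def atLeast0LessThan)
      thus "cmod ((A * B) $$ (i, j)) \<le> (\<Sum>k<n. cmod (A $$ (i, k)) * cmod (B $$ (k, j)))"
        by (simp add: norm_mult[symmetric] norm_sum)
    qed
    also have "\<dots> = (\<Sum>k<n. cmod (A $$ (i, k)) * (\<Sum>j<nc. cmod (B $$ (k, j))))"
      by (subst sum.swap) (simp add: sum_distrib_left)
    also have "\<dots> \<le> (\<Sum>k<n. cmod (A $$ (i, k)) * sum_norm B)"
    proof (intro sum_mono mult_left_mono)
      fix k assume "k \<in> {..<n}"
      thus "(\<Sum>j<nc. cmod (B $$ (k, j))) \<le> sum_norm B"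
        unfolding sum_norm_def using B by (simp, intro member_le_sum) (auto simp: sum_nonneg)
    qed simp
    finally show ?thesis by (simp add: sum_distrib_right)
  qed
  have "sum_norm (A * B) \<le> (\<Sum>i<nr. (\<Sum>k<n. cmod (A $$ (i, k))) * sum_norm B)"
    unfolding sum_norm_def[of "A * B"] using A B row by (auto intro!: sum_mono)
  also have "\<dots> = sum_norm A * sum_norm B" using A by (simp add: sum_norm_def[of A] sum_distrib_right)
  finally show ?thesis .
qed

text \<open>In each square, one of the two factors is bounded by the whole norm.\<close>

lemma frobenius_le_sum_norm: "frobenius_norm A \<le> sum_norm A"
proof -
  have "(\<Sum>i<dim_row A. \<Sum>j<dim_col A. (cmod (A $$ (i, j)))\<^sup>2)
      \<le> (\<Sum>i<dim_row A. \<Sum>j<dim_col A. cmod (A $$ (i, j)) * sum_norm A)"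
    unfolding power2_eq_square by (intro sum_mono mult_left_mono sum_norm_entry) auto
  also have "\<dots> = (sum_norm A)\<^sup>2"
    by (simp add: sum_distrib_right[symmetric] power2_eq_square flip: sum_norm_def)
  finally show ?thesis
    unfolding frobenius_norm_def by (intro real_le_lsqrt sum_norm_nonneg)
qed

lemma sum_norm_le_frobenius:
  "sum_norm A \<le> real (dim_row A * dim_col A) * frobenius_norm A"
proof -
  have "cmod (A $$ (i, j)) \<le> frobenius_norm A" if "i < dim_row A" "j < dim_col A" for i j
  proof -
    have "(cmod (A $$ (i, j)))\<^sup>2 \<le> (\<Sum>j<dim_col A. (cmod (A $$ (i, j)))\<^sup>2)"
      using that by (intro member_le_sum) auto
    also have "\<dots> \<le> (\<Sum>i<dim_row A. \<Sum>j<dim_col A. (cmod (A $$ (i, j)))\<^sup>2)"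
      using that by (intro member_le_sum) (auto simp: sum_nonneg)
    finally show ?thesis unfolding frobenius_norm_def by (rule real_le_rsqrt)
  qed
  hence "sum_norm A \<le> (\<Sum>i<dim_row A. \<Sum>j<dim_col A. frobenius_norm A)"
    unfolding sum_norm_def by (intro sum_mono) auto
  thus ?thesis by (simp add: algebra_simps)
qed

subsection \<open>The resolvent\<close>

lemma closed_loop:
  assumes G: "G \<in> carrier_mat n n" and det: "det (1\<^sub>m n - G) \<noteq> 0"
  shows "closed_loop n G \<in> carrier_mat n n"
    and "(1\<^sub>m n - G) * closed_loop n G = 1\<^sub>m n"
    and "closed_loop n G * (1\<^sub>m n - G) = 1\<^sub>m n"
proof -
  have A: "1\<^sub>m n - G \<in> carrier_mat n n" using G by auto
  obtain T where T: "mat_inverse (1\<^sub>m n - G) = Some T"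
    using mat_inverse(1)[OF A] det_non_zero_imp_unit[OF A det] by fastforce
  show "closed_loop n G \<in> carrier_mat n n" "(1\<^sub>m n - G) * closed_loop n G = 1\<^sub>m n"
    "closed_loop n G * (1\<^sub>m n - G) = 1\<^sub>m n"
    using mat_inverse(2)[OF A T] by (auto simp: closed_loop_def T)
qed

lemma adj_mat_closed_loop:
  assumes G: "G \<in> carrier_mat n n" and det: "det (1\<^sub>m n - G) \<noteq> 0"
  shows "adj_mat (1\<^sub>m n - G) = det (1\<^sub>m n - G) \<cdot>\<^sub>m closed_loop n G"
proof -
  let ?A = "1\<^sub>m n - G" and ?T = "closed_loop n G"
  have A: "?A \<in> carrier_mat n n" using G by auto
  note T = closed_loop[OF G det]
  have "adj_mat ?A = (?T * ?A) * adj_mat ?A" using adj_mat(1)[OF A] by (simp add: T)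
  also have "\<dots> = ?T * (det ?A \<cdot>\<^sub>m 1\<^sub>m n)"
    using assoc_mult_mat[OF T(1) A adj_mat(1)[OF A]] by (simp add: adj_mat(2)[OF A])
  also have "\<dots> = det ?A \<cdot>\<^sub>m ?T"
    using mult_smult_distrib[OF T(1), of "1\<^sub>m n" n "det ?A"] T(1) by simp
  finally show ?thesis .
qed

text \<open>\<open>invertible_mat\<close> does not prescribe the shape of the inverse. Comparing
  dimensions in the two product equations shows that it is \<open>n\<close> by \<open>n\<close>, and
  then \<open>det\<close> is multiplicative.\<close>

lemma det_nonzero_of_invertible:
  fixes A :: "'a :: field mat"
  assumes "A \<in> carrier_mat n n" and "invertible_mat A"
  shows "det A \<noteq> 0"
proof -
  obtain B where B: "A * B = 1\<^sub>m n" "B * A = 1\<^sub>m (dim_row B)"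
    using assms unfolding invertible_mat_def inverts_mat_def by auto
  have "dim_col B = n" using arg_cong[OF B(1), of dim_col] by simp
  moreover have "dim_row B = n" using arg_cong[OF B(2), of dim_col] assms(1) by simp
  ultimately have "B \<in> carrier_mat n n" by auto
  from det_mult[OF assms(1) this] B(1) show ?thesis by auto
qed

lemma invertible_of_det_nonzero:
  fixes G :: "complex mat"
  assumes "G \<in> carrier_mat n n" and "det (1\<^sub>m n - G) \<noteq> 0"
  shows "invertible_mat (1\<^sub>m n - G)"
  using closed_loop[OF assms] assms(1)
  by (auto simp: invertible_mat_def inverts_mat_def intro!: exI[of _ "closed_loop n G"])

lemma network_matrix_iff:
  "network_matrix n E G \<longleftrightarrow> consistent n E G \<and> det (1\<^sub>m n - G) \<noteq> 0"
proof -
  have "invertible_mat (1\<^sub>m n - G) \<longleftrightarrow> det (1\<^sub>m n - G) \<noteq> 0" if "G \<in> carrier_mat n n"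
    using det_nonzero_of_invertible[OF minus_carrier_mat[OF that]] invertible_of_det_nonzero[OF that]
    by blast
  thus ?thesis by (auto simp: network_matrix_def consistent_def)
qed

text \<open>Both forms come from placing G' - G = (I - G) - (I - G') between the two inverses, in
  either order. Substituting one form into the other gives the second-order identity.\<close>

lemma resolvent:
  assumes G: "G \<in> carrier_mat n n" "det (1\<^sub>m n - G) \<noteq> 0"
    and G': "G' \<in> carrier_mat n n" "det (1\<^sub>m n - G') \<noteq> 0"
  shows "closed_loop n G' = closed_loop n G + closed_loop n G' * (G' - G) * closed_loop n G"
    and "closed_loop n G' = closed_loop n G + closed_loop n G * (G' - G) * closed_loop n G'"
proof -
  let ?A = "1\<^sub>m n - G" and ?T = "closed_loop n G" and ?A' = "1\<^sub>m n - G'" and ?T' = "closed_loop n G'"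
  have A: "?A \<in> carrier_mat n n" and A': "?A' \<in> carrier_mat n n" using G G' by auto
  note T = closed_loop[OF G] and T' = closed_loop[OF G']
  have D: "G' - G = ?A - ?A'" using G(1) G'(1) by (auto intro!: eq_matI)
  have "?T' * (?A - ?A') = ?T' * ?A - 1\<^sub>m n"
    using T'(1) A A' by (simp add: mult_minus_distrib_mat T'(3))
  hence "?T' * (G' - G) * ?T = ?T' * ?A * ?T - 1\<^sub>m n * ?T"
    unfolding D using T(1) T'(1) A by (simp add: minus_mult_distrib_mat[where nr = n and n = n])
  also have "?T' * ?A * ?T = ?T'"
    using assoc_mult_mat[OF T'(1) A T(1)] T'(1) by (simp add: T(2))
  finally show "?T' = ?T + ?T' * (G' - G) * ?T"
    using T(1) T'(1) by (auto intro!: eq_matI)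
  have "?T * (?A - ?A') = 1\<^sub>m n - ?T * ?A'"
    using T(1) A A' by (simp add: mult_minus_distrib_mat T(3))
  hence "?T * (G' - G) * ?T' = 1\<^sub>m n * ?T' - ?T * ?A' * ?T'"
    unfolding D using T(1) T'(1) A' by (simp add: minus_mult_distrib_mat[where nr = n and n = n])
  also have "?T * ?A' * ?T' = ?T"
    using assoc_mult_mat[OF T(1) A' T'(1)] T(1) by (simp add: T'(2))
  finally show "?T' = ?T + ?T * (G' - G) * ?T'"
    using T(1) T'(1) by (auto intro!: eq_matI)
qed

text \<open>An exact identity: the first form of \<open>resolvent\<close> replaces the last factor
  \<open>T'\<close> of the second. The remainder still contains \<open>T'\<close>, which
  \<open>sum_norm_closed_loop_le\<close> controls.\<close>

lemma resolvent_second_order: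
  assumes G: "G \<in> carrier_mat n n" "det (1\<^sub>m n - G) \<noteq> 0"
    and G': "G' \<in> carrier_mat n n" "det (1\<^sub>m n - G') \<noteq> 0"
  defines "T \<equiv> closed_loop n G" and "T' \<equiv> closed_loop n G'" and "D \<equiv> G' - G"
  shows "T' = T + T * D * T + T * D * (T' * D * T)"
proof -
  have c: "T \<in> carrier_mat n n" "T' \<in> carrier_mat n n" "D \<in> carrier_mat n n"
    using closed_loop(1)[OF G] closed_loop(1)[OF G'] G G' by (auto simp: T_def T'_def D_def)
  have "T * D * T' = T * D * (T + T' * D * T)"
    using resolvent(1)[OF G G'] unfolding T_def T'_def D_def by simp
  also have "\<dots> = T * D * T + T * D * (T' * D * T)"
    using c by (intro mult_add_distrib_mat[where nc = n]) auto
  finally have "T' = T + (T * D * T + T * D * (T' * D * T))"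
    using resolvent(2)[OF G G'] unfolding T_def T'_def D_def by simp
  also have "\<dots> = T + T * D * T + T * D * (T' * D * T)"
    using c by (intro assoc_add_mat[symmetric, where nr = n and nc = n]) auto
  finally show ?thesis .
qed

text \<open>The correction term in the first form of \<open>resolvent\<close> has at most half the
  norm of \<open>closed_loop n G'\<close> itself, so it is absorbed on the left.\<close>

lemma sum_norm_closed_loop_le:
  assumes G: "G \<in> carrier_mat n n" "det (1\<^sub>m n - G) \<noteq> 0"
    and G': "G' \<in> carrier_mat n n" "det (1\<^sub>m n - G') \<noteq> 0"
    and small: "sum_norm (G' - G) * sum_norm (closed_loop n G) \<le> 1 / 2"
  shows "sum_norm (closed_loop n G') \<le> 2 * sum_norm (closed_loop n G)"
proof -
  let ?T = "closed_loop n G" and ?T' = "closed_loop n G'" and ?D = "G' - G"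
  have c: "?T \<in> carrier_mat n n" "?T' \<in> carrier_mat n n" "?D \<in> carrier_mat n n"
    using closed_loop(1)[OF G] closed_loop(1)[OF G'] G by auto
  have "sum_norm ?T' \<le> sum_norm ?T + sum_norm (?T' * ?D * ?T)"
    using sum_norm_add[OF c(1), of "?T' * ?D * ?T"] c resolvent(1)[OF G G'] by simp
  also have "sum_norm (?T' * ?D * ?T) \<le> sum_norm (?T' * ?D) * sum_norm ?T"
    using c by (intro sum_norm_mult[where n = n and nr = n and nc = n]) auto
  also have "\<dots> \<le> sum_norm ?T' * sum_norm ?D * sum_norm ?T"
    using sum_norm_mult[OF c(2,3)] by (intro mult_right_mono sum_norm_nonneg)
  also have "\<dots> \<le> sum_norm ?T' * (1 / 2)"
    using small sum_norm_nonneg[of ?T'] by (simp only: mult.assoc mult_left_mono)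
  finally show ?thesis by simp
qed

section \<open>Index bounds, and full column rank as a trivial kernel\<close>

lemma nth_less_bound: "set xs \<subseteq> {..<n} \<Longrightarrow> i < length xs \<Longrightarrow> xs ! i < n"
  for n :: nat
  using nth_mem by blast

lemma edge_nodes_less:
  fixes n :: nat
  assumes "set es \<subseteq> {..<n} \<times> {..<n}" and "k < length es"
  shows "fst (es ! k) < n" and "snd (es ! k) < n"
proof -
  have "es ! k \<in> {..<n} \<times> {..<n}" using assms nth_mem by blast
  thus "fst (es ! k) < n" "snd (es ! k) < n" by (auto simp: mem_Times_iff)
qed

text \<open>Linear independence concerns the set of columns, so repetitions are treated apart. A
  repetition leaves fewer than \<open>nc\<close> distinct columns and so lowers the rank; it also
  puts the difference of two unit vectors into the kernel.\<close>

lemma mat_rank_eq_ncols_iff: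
  assumes A: "A \<in> carrier_mat nr nc"
  shows "mat_rank A = nc \<longleftrightarrow> (\<forall>w\<in>carrier_vec nc. A *\<^sub>v w = 0\<^sub>v nr \<longrightarrow> w = 0\<^sub>v nc)"
proof -
  interpret vec_space "TYPE(complex)" nr .
  have rank: "mat_rank A = rank A" using A by (simp add: mat_rank_def)
  show ?thesis
  proof
    assume "mat_rank A = nc"
    hence full: "rank A = nc" by (simp add: rank)
    have "distinct (cols A)"
    proof (rule ccontr)
      assume "\<not> distinct (cols A)"
      hence less: "card (set (cols A)) < nc"
        using A card_length[of "cols A"] card_distinct[of "cols A"] by fastforce
      obtain S where S: "maximal S (\<lambda>T. T \<subseteq> set (cols A) \<and> lin_indpt T)"
        using maximal_exists[of "\<lambda>T. T \<subseteq> set (cols A) \<and> lin_indpt T" "card (set (cols A))" "{}"]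
        by (meson List.finite_set card_mono empty_iff empty_subsetI finite_lin_indpt2 rev_finite_subset)
      hence "card S \<le> card (set (cols A))" by (simp add: card_mono maximal_def)
      with less rank_card_indpt[OF A S] full show False by simp
    qed
    with full_rank_lin_indpt[OF A full this] lin_depI[OF A]
    show "\<forall>w\<in>carrier_vec nc. A *\<^sub>v w = 0\<^sub>v nr \<longrightarrow> w = 0\<^sub>v nc" by blast
  next
    assume ker: "\<forall>w\<in>carrier_vec nc. A *\<^sub>v w = 0\<^sub>v nr \<longrightarrow> w = 0\<^sub>v nc"
    have dist: "distinct (cols A)"
    proof (rule ccontr)
      assume "\<not> distinct (cols A)"
      then obtain i j where ij: "i < nc" "j < nc" "i \<noteq> j" "col A i = col A j"
        using A by (auto simp: distinct_conv_nth)
      let ?w = "unit_vec nc i - unit_vec nc j :: complex vec"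
      have unit: "A *\<^sub>v unit_vec nc i = col A i" if "i < nc" for i
        using A that by (auto intro!: eq_vecI simp: scalar_prod_right_unit)
      have "A *\<^sub>v ?w = A *\<^sub>v unit_vec nc i - A *\<^sub>v unit_vec nc j"
        using A by (intro mult_minus_distrib_mat_vec) auto
      also have "\<dots> = 0\<^sub>v nr" using A ij by (simp add: unit)
      finally have "?w = 0\<^sub>v nc" using ker by auto
      hence "?w $ i = 0" using ij by simp
      thus False using ij by simp
    qed
    have "lin_indpt (set (cols A))"
    proof
      assume "lin_dep (set (cols A))"
      from lin_depE[OF A this dist] ker show False by blast
    qed
    thus "mat_rank A = nc" unfolding rank by (rule lin_indpt_full_rank[OF A dist])
  qed
qed

subsection \<open>Network matrices and the rank of K\<close>

lemma measurement_mat_carrier: "measurement_mat n cs \<in> carrier_mat (length cs) n"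
  and excitation_mat_carrier: "excitation_mat n bs \<in> carrier_mat n (length bs)"
  by (auto simp: measurement_mat_def excitation_mat_def)

lemma measurement_excitation:
  assumes X: "X \<in> carrier_mat n n" and bs: "set bs \<subseteq> {..<n}" and cs: "set cs \<subseteq> {..<n}"
  shows "measurement_mat n cs * X * excitation_mat n bs
    = mat (length cs) (length bs) (\<lambda>(a, b). X $$ (cs ! a, bs ! b))"
proof (rule eq_matI)
  fix a b assume "a < dim_row (mat (length cs) (length bs) (\<lambda>(a, b). X $$ (cs ! a, bs ! b)))"
    and "b < dim_col (mat (length cs) (length bs) (\<lambda>(a, b). X $$ (cs ! a, bs ! b)))"
  hence a: "a < length cs" and b: "b < length bs" by auto
  note can = nth_less_bound[OF cs a] and bbn = nth_less_bound[OF bs b]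
  have M: "measurement_mat n cs \<in> carrier_mat (length cs) n"
    and B: "excitation_mat n bs \<in> carrier_mat n (length bs)"
    by (auto simp: measurement_mat_def excitation_mat_def)
  have row: "row (measurement_mat n cs) a = unit_vec n (cs ! a)"
    using a by (simp add: measurement_mat_def)
  have col: "col (excitation_mat n bs) b = unit_vec n (bs ! b)"
    using b by (simp add: excitation_mat_def)
  have MX: "(measurement_mat n cs * X) $$ (a, j) = X $$ (cs ! a, j)" if "j < n" for j
    using a M X that can by (simp add: row scalar_prod_left_unit[of _ n])
  have "(measurement_mat n cs * X * excitation_mat n bs) $$ (a, b)
      = row (measurement_mat n cs * X) a \<bullet> unit_vec n (bs ! b)"
    unfolding col[symmetric] using a b M B X by (intro index_mult_mat) auto
  also have "\<dots> = row (measurement_mat n cs * X) a $ (bs ! b)"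
    using X bbn by (intro scalar_prod_right_unit) auto
  also have "\<dots> = X $$ (cs ! a, bs ! b)" using a M X bbn MX[OF bbn] by simp
  finally show "(measurement_mat n cs * X * excitation_mat n bs) $$ (a, b)
      = mat (length cs) (length bs) (\<lambda>(a, b). X $$ (cs ! a, bs ! b)) $$ (a, b)"
    using a b by simp
qed (auto simp: measurement_mat_def excitation_mat_def)

lemma param_mat_carrier [simp]: "param_mat n es x \<in> carrier_mat n n"
  by (simp add: param_mat_def)

lemma param_mat_dim [simp]: "dim_row (param_mat n es x) = n" "dim_col (param_mat n es x) = n"
  by (auto simp: param_mat_def)

lemma param_mat_diff:
  assumes "x \<in> carrier_vec (length es)" and "y \<in> carrier_vec (length es)"
  shows "param_mat n es x - param_mat n es y = param_mat n es (x - y)"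
  using assms
  by (auto intro!: eq_matI sum.cong simp: param_mat_def sum_subtractf[symmetric])

lemma param_mat_smult:
  assumes "x \<in> carrier_vec (length es)"
  shows "param_mat n es (c \<cdot>\<^sub>v x) = c \<cdot>\<^sub>m param_mat n es x"
  using assms by (auto intro!: eq_matI sum.cong simp: param_mat_def sum_distrib_left)

text \<open>An edge is a pair (source, target), but its matrix position is (target, source); hence
  the swapped arguments of \<open>f\<close>.\<close>

lemma sum_delta_pair:
  fixes f :: "nat \<Rightarrow> nat \<Rightarrow> 'a :: comm_monoid_add"
  assumes "fst e < n" and "snd e < n"
  shows "(\<Sum>p<n. \<Sum>s<n. if e = (s, p) then f p s else 0) = f (snd e) (fst e)"
proof -
  have "(\<Sum>s<n. if e = (s, p) then f p s else 0) = (if p = snd e then f p (fst e) else 0)" for p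
  proof -
    have "(\<Sum>s<n. if e = (s, p) then f p s else 0)
        = (\<Sum>s<n. if s = fst e then (if p = snd e then f p s else 0) else 0)"
      by (intro sum.cong) (auto simp: prod_eq_iff)
    thus ?thesis using assms by simp
  qed
  thus ?thesis using assms by simp
qed

lemma sum_norm_param_mat_le:
  assumes es: "set es \<subseteq> {..<n} \<times> {..<n}"
  shows "sum_norm (param_mat n es x) \<le> (\<Sum>k<length es. cmod (x $ k))"
proof -
  have "sum_norm (param_mat n es x)
      \<le> (\<Sum>p<n. \<Sum>s<n. \<Sum>k<length es. if es ! k = (s, p) then cmod (x $ k) else 0)"
    unfolding sum_norm_def param_mat_def
    by (auto intro!: sum_mono order_trans[OF norm_sum] simp: if_distrib[of cmod])
  also have "\<dots> = (\<Sum>k<length es. \<Sum>p<n. \<Sum>s<n. if es ! k = (s, p) then cmod (x $ k) else 0)"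
    by (subst (2) sum.swap, subst sum.swap) (simp add: sum.swap[of _ "{..<length es}"])
  also have "\<dots> = (\<Sum>k<length es. cmod (x $ k))"
  proof (rule sum.cong)
    fix k assume "k \<in> {..<length es}"
    hence "fst (es ! k) < n" "snd (es ! k) < n" using edge_nodes_less[OF es] by auto
    thus "(\<Sum>p<n. \<Sum>s<n. if es ! k = (s, p) then cmod (x $ k) else 0) = cmod (x $ k)"
      by (subst sum_delta_pair) auto
  qed simp
  finally show ?thesis .
qed

text \<open>The product is linear in \<open>w\<close>, and \<open>w $ k\<close> enters a single
  entry of \<open>param_mat\<close>. When both outer factors are the resolvent, the coefficients of
  \<open>w $ k\<close> are the entries of \<open>K_mat\<close>.\<close>

lemma mult_param_mat_mult_entry:
  assumes es: "set es \<subseteq> {..<n} \<times> {..<n}"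
    and P: "P \<in> carrier_mat n n" and Q: "Q \<in> carrier_mat n n" and c: "c < n" and b: "b < n"
  shows "(P * param_mat n es w * Q) $$ (c, b)
    = (\<Sum>k<length es. P $$ (c, snd (es ! k)) * Q $$ (fst (es ! k), b) * w $ k)"
proof -
  have "(P * param_mat n es w * Q) $$ (c, b)
      = (\<Sum>s<n. (\<Sum>p<n. P $$ (c, p) * param_mat n es w $$ (p, s)) * Q $$ (s, b))"
    using P Q c b by (simp add: scalar_prod_def atLeast0LessThan)
  also have "\<dots> = (\<Sum>s<n. \<Sum>p<n. \<Sum>k<length es.
      if es ! k = (s, p) then P $$ (c, p) * Q $$ (s, b) * w $ k else 0)"
    by (auto simp: param_mat_def sum_distrib_left sum_distrib_right intro!: sum.cong)
  also have "\<dots> = (\<Sum>k<length es. \<Sum>p<n. \<Sum>s<n.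
      if es ! k = (s, p) then P $$ (c, p) * Q $$ (s, b) * w $ k else 0)"
    by (subst sum.swap, subst (2) sum.swap, subst sum.swap)
      (simp add: sum.swap[of _ "{..<length es}"])
  also have "\<dots> = (\<Sum>k<length es. P $$ (c, snd (es ! k)) * Q $$ (fst (es ! k), b) * w $ k)"
  proof (rule sum.cong)
    fix k assume "k \<in> {..<length es}"
    hence "fst (es ! k) < n" "snd (es ! k) < n" using edge_nodes_less[OF es] by auto
    thus "(\<Sum>p<n. \<Sum>s<n. if es ! k = (s, p) then P $$ (c, p) * Q $$ (s, b) * w $ k else 0)
        = P $$ (c, snd (es ! k)) * Q $$ (fst (es ! k), b) * w $ k"
      by (subst sum_delta_pair) auto
  qed simp
  finally show ?thesis .
qed

lemma param_mat_at_edge: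
  assumes "distinct es" and es: "set es \<subseteq> {..<n} \<times> {..<n}" and k: "k < length es"
  shows "param_mat n es w $$ (snd (es ! k), fst (es ! k)) = w $ k"
proof -
  note e = edge_nodes_less[OF es k]
  have "(\<Sum>l<length es. if es ! l = es ! k then w $ l else 0)
      = (\<Sum>l<length es. if l = k then w $ l else 0)"
    using assms(1) k by (intro sum.cong) (auto simp: nth_eq_iff_index_eq)
  thus ?thesis using e k by (simp add: param_mat_def)
qed

lemma consistent_param_mat: "consistent n (set es) (param_mat n es w)"
proof -
  have "es ! k \<noteq> (j, i)" if "(j, i) \<notin> set es" "k < length es" for i j k
    using that nth_mem by metis
  thus ?thesis unfolding consistent_def by (auto simp: param_mat_def intro!: sum.neutral)
qed

lemma consistent_imp_param_mat:
  assumes dist: "distinct es" and es: "set es \<subseteq> {..<n} \<times> {..<n}"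
    and D: "consistent n (set es) D"
  shows "\<exists>w\<in>carrier_vec (length es). D = param_mat n es w"
proof
  let ?w = "vec (length es) (\<lambda>k. D $$ (snd (es ! k), fst (es ! k)))"
  show "?w \<in> carrier_vec (length es)" by simp
  show "D = param_mat n es ?w"
  proof (rule eq_matI)
    fix i j assume "i < dim_row (param_mat n es ?w)" "j < dim_col (param_mat n es ?w)"
    hence ij: "i < n" "j < n" by auto
    show "D $$ (i, j) = param_mat n es ?w $$ (i, j)"
    proof (cases "(j, i) \<in> set es")
      case True
      then obtain k where k: "k < length es" "es ! k = (j, i)" by (auto simp: in_set_conv_nth)
      show ?thesis using param_mat_at_edge[OF dist es k(1), of ?w] k by simp
    next
      case False
      thus ?thesis using D consistent_param_mat[of n es ?w] ij by (auto simp: consistent_def)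
    qed
  qed (use D in \<open>auto simp: consistent_def\<close>)
qed

lemma param_mat_eq_0_iff:
  assumes "distinct es" and "set es \<subseteq> {..<n} \<times> {..<n}" and w: "w \<in> carrier_vec (length es)"
  shows "param_mat n es w = 0\<^sub>m n n \<longleftrightarrow> w = 0\<^sub>v (length es)"
proof
  assume 0: "param_mat n es w = 0\<^sub>m n n"
  show "w = 0\<^sub>v (length es)"
  proof (rule eq_vecI)
    fix k assume "k < dim_vec (0\<^sub>v (length es) :: complex vec)"
    hence k: "k < length es" by simp
    from edge_nodes_less[OF assms(2) k]
    show "w $ k = 0\<^sub>v (length es) $ k" using param_mat_at_edge[OF assms(1,2) k, of w] 0 k by simp
  qed (use w in auto)
qed (auto intro!: eq_matI sum.neutral simp: param_mat_def)

lemma edge_mat_entry: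
  assumes k: "k < length es" and l: "l < n * n"
  shows "edge_mat n es $$ (l, k) = (if es ! k = (l div n, l mod n) then 1 else 0)"
proof -
  have n: "n > 0" using l by (cases n) auto
  have ln: "l mod n < n" "l div n < n" using n l by (auto simp: less_mult_imp_div_less)
  have "edge_mat n es $$ (l, k) = param_mat n es (unit_vec (length es) k) $$ (l mod n, l div n)"
    using k l by (simp add: edge_mat_def mat_of_cols_index vec_of_mat_def)
  also have "\<dots> = (\<Sum>i<length es.
      if es ! i = (l div n, l mod n) then unit_vec (length es) k $ i else 0)"
    using ln by (simp add: param_mat_def)
  also have "\<dots> = (\<Sum>i<length es. if i = k then (if es ! k = (l div n, l mod n) then 1 else 0) else 0)"
    using k by (intro sum.cong) auto
  also have "\<dots> = (if es ! k = (l div n, l mod n) then 1 else 0)" using k by simp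
  finally show ?thesis .
qed

lemma K_mat_carrier:
  "K_mat n es bs cs x \<in> carrier_mat (length bs * length cs) (length es)"
  by (intro carrier_matI)
    (simp_all add: K_mat_def Let_def kronecker_def edge_mat_def measurement_mat_def excitation_mat_def)

lemma K_mat_entry:
  assumes T: "closed_loop n (param_mat n es x) \<in> carrier_mat n n" (is "?T \<in> _")
    and es: "set es \<subseteq> {..<n} \<times> {..<n}" and bs: "set bs \<subseteq> {..<n}" and cs: "set cs \<subseteq> {..<n}"
    and i: "i < length bs * length cs" and k: "k < length es"
  shows "K_mat n es bs cs x $$ (i, k) =
    ?T $$ (cs ! (i mod length cs), snd (es ! k)) * ?T $$ (fst (es ! k), bs ! (i div length cs))"
proof -
  \<comment> \<open>Row \<open>i\<close> of the Kronecker product belongs to the measured node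
    number \<open>a\<close> and the excited node number \<open>b\<close>, because the columns of the
    response are stacked.\<close>
  define a where "a = i mod length cs"
  define b where "b = i div length cs"
  have "length cs > 0" using i by (cases cs) auto
  hence a: "a < length cs" and b: "b < length bs"
    using i by (auto simp: a_def b_def less_mult_imp_div_less)
  note can = nth_less_bound[OF cs a] and bbn = nth_less_bound[OF bs b]
  note ek = edge_nodes_less[OF es k]
  let ?L = "transpose_mat (excitation_mat n bs) * transpose_mat ?T" and ?R = "measurement_mat n cs * ?T"
  have M: "measurement_mat n cs \<in> carrier_mat (length cs) n"
    and B: "excitation_mat n bs \<in> carrier_mat n (length bs)"
    by (auto simp: measurement_mat_def excitation_mat_def)
  have row: "row (measurement_mat n cs) a = unit_vec n (cs ! a)"
    using a by (simp add: measurement_mat_def)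
  have col: "col (excitation_mat n bs) b = unit_vec n (bs ! b)"
    using b by (simp add: excitation_mat_def)
  have R: "?R $$ (a, j) = ?T $$ (cs ! a, j)" if "j < n" for j
    using a M T that can by (simp add: row scalar_prod_left_unit[of _ n])
  have L: "?L $$ (b, j) = ?T $$ (j, bs ! b)" if "j < n" for j
    using b B T that bbn by (simp add: col scalar_prod_left_unit[of _ n])
  \<comment> \<open>Position of the edge \<open>k\<close> in the stacked matrix: its source is the
    column and its target the row. Column \<open>k\<close> of \<open>edge_mat\<close> is 1 there and
    0 elsewhere.\<close>
  define l0 where "l0 = fst (es ! k) * n + snd (es ! k)"
  have l0: "l0 div n = fst (es ! k)" "l0 mod n = snd (es ! k)" using ek by (auto simp: l0_def)
  have "l0 < (fst (es ! k) + 1) * n" using ek by (simp add: l0_def)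
  also have "\<dots> \<le> n * n" using ek by (intro mult_right_mono) auto
  finally have l0n: "l0 < n * n" .
  have iff: "es ! k = (l div n, l mod n) \<longleftrightarrow> l = l0" for l
    using l0 div_mult_mod_eq[of l n] by (auto simp: l0_def prod_eq_iff)
  let ?Kr = "kronecker ?L ?R"
  have dKr: "?Kr \<in> carrier_mat (length bs * length cs) (n * n)"
    using M B T by (simp add: kronecker_def)
  have E: "edge_mat n es \<in> carrier_mat (n * n) (length es)"
    by (intro carrier_matI) (simp_all add: edge_mat_def)
  have "K_mat n es bs cs x $$ (i, k) = (\<Sum>l<n * n. ?Kr $$ (i, l) * edge_mat n es $$ (l, k))"
    using i k dKr E by (simp add: K_mat_def Let_def scalar_prod_def atLeast0LessThan)
  also have "\<dots> = (\<Sum>l<n * n. if l = l0 then ?Kr $$ (i, l) else 0)"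
    using k by (intro sum.cong) (auto simp: edge_mat_entry iff)
  also have "\<dots> = ?Kr $$ (i, l0)" using l0n by simp
  also have "\<dots> = ?L $$ (b, fst (es ! k)) * ?R $$ (a, snd (es ! k))"
    using i l0n M B T by (simp add: kronecker_def l0 a_def b_def)
  finally show ?thesis using L R ek by (simp add: a_def b_def)
qed

text \<open>By vec(P X Q) = (Q^T \<otimes> P) vec(X), the vector K w is vec(C T G(w) T B). The proof
  verifies this entry by entry.\<close>

lemma K_mat_full_rank_iff:
  assumes x: "x \<in> admissible n es"
    and es: "set es \<subseteq> {..<n} \<times> {..<n}" and bs: "set bs \<subseteq> {..<n}" and cs: "set cs \<subseteq> {..<n}"
  defines "T \<equiv> closed_loop n (param_mat n es x)"
  shows "mat_rank (K_mat n es bs cs x) = length es \<longleftrightarrow>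
    (\<forall>w\<in>carrier_vec (length es).
      measurement_mat n cs * (T * param_mat n es w * T) * excitation_mat n bs
        = 0\<^sub>m (length cs) (length bs) \<longrightarrow> w = 0\<^sub>v (length es))"
proof -
  have T: "T \<in> carrier_mat n n"
    unfolding T_def using x by (intro closed_loop) (auto simp: admissible_def)
  let ?q = "length cs" and ?p = "length bs"
  note K = K_mat_carrier[of n es bs cs x]
  have Kw: "(K_mat n es bs cs x *\<^sub>v w) $ i
      = (T * param_mat n es w * T) $$ (cs ! (i mod ?q), bs ! (i div ?q))"
    if i: "i < ?p * ?q" and w: "w \<in> carrier_vec (length es)" for i w
  proof -
    have q: "?q > 0" using i by (cases cs) auto
    have "cs ! (i mod ?q) < n" using q by (intro nth_less_bound[OF cs]) simp
    moreover have "bs ! (i div ?q) < n"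
      using i by (intro nth_less_bound[OF bs]) (simp add: less_mult_imp_div_less)
    ultimately have "(T * param_mat n es w * T) $$ (cs ! (i mod ?q), bs ! (i div ?q))
        = (\<Sum>k<length es. T $$ (cs ! (i mod ?q), snd (es ! k)) * T $$ (fst (es ! k), bs ! (i div ?q)) * w $ k)"
      by (intro mult_param_mat_mult_entry es T)
    also have "\<dots> = (\<Sum>k<length es. K_mat n es bs cs x $$ (i, k) * w $ k)"
      using T i unfolding T_def by (intro sum.cong) (auto simp: K_mat_entry[OF _ es bs cs])
    also have "\<dots> = (K_mat n es bs cs x *\<^sub>v w) $ i"
      using K i w by (simp add: scalar_prod_def atLeast0LessThan)
    finally show ?thesis ..
  qed
  have "K_mat n es bs cs x *\<^sub>v w = 0\<^sub>v (?p * ?q) \<longleftrightarrow>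
      measurement_mat n cs * (T * param_mat n es w * T) * excitation_mat n bs = 0\<^sub>m ?q ?p"
    (is "?l \<longleftrightarrow> ?r") if w: "w \<in> carrier_vec (length es)" for w
  proof -
    let ?X = "T * param_mat n es w * T"
    have X: "?X \<in> carrier_mat n n" using T by auto
    have "?l \<longleftrightarrow> (\<forall>i<?p * ?q. ?X $$ (cs ! (i mod ?q), bs ! (i div ?q)) = 0)"
      using K by (auto simp: vec_eq_iff Kw[OF _ w] simp del: index_mult_mat_vec)
    also have "\<dots> \<longleftrightarrow> (\<forall>a<?q. \<forall>b<?p. ?X $$ (cs ! a, bs ! b) = 0)"
    proof (intro iffI allI impI)
      fix a b assume *: "\<forall>i<?p * ?q. ?X $$ (cs ! (i mod ?q), bs ! (i div ?q)) = 0" "a < ?q" "b < ?p"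
      have "b * ?q + a < (b + 1) * ?q" using * by simp
      also have "\<dots> \<le> ?p * ?q" using * by (intro mult_right_mono) auto
      finally have "?X $$ (cs ! ((b * ?q + a) mod ?q), bs ! ((b * ?q + a) div ?q)) = 0"
        by (rule *(1)[rule_format])
      moreover have "(b * ?q + a) mod ?q = a" using *(2) by simp
      moreover have "?q \<noteq> 0" using *(2) by linarith
      hence "(b * ?q + a) div ?q = b"
        by (simp only: div_mult_self3 div_less[OF *(2)] add_0_right not_False_eq_True)
      ultimately show "?X $$ (cs ! a, bs ! b) = 0" by simp
    next
      fix i assume *: "\<forall>a<?q. \<forall>b<?p. ?X $$ (cs ! a, bs ! b) = 0" "i < ?p * ?q"
      have "?q > 0" using * by (cases cs) auto
      thus "?X $$ (cs ! (i mod ?q), bs ! (i div ?q)) = 0"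
        using * by (auto simp: less_mult_imp_div_less)
    qed
    also have "\<dots> \<longleftrightarrow> ?r"
      unfolding measurement_excitation[OF X bs cs] by (auto simp: mat_eq_iff)
    finally show ?thesis .
  qed
  thus ?thesis using mat_rank_eq_ncols_iff[OF K] by auto
qed

subsection \<open>Local identifiability\<close>

text \<open>Only the linear left inverse at the one point \<open>x\<close> enters, so
  \<open>U\<close> is a family of numbers. The neighbourhood is taken so small that the quadratic
  estimate for the size \<open>d\<close> of the perturbation becomes
  \<open>d \<le> d / 2\<close>.\<close>

lemma locally_identifiable_if_left_inverse:
  assumes x: "x \<in> admissible n es"
    and dist: "distinct es" and es: "set es \<subseteq> {..<n} \<times> {..<n}"
    and bs: "set bs \<subseteq> {..<n}" and cs: "set cs \<subseteq> {..<n}"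
  defines "T \<equiv> closed_loop n (param_mat n es x)"
  defines "Y \<equiv> \<lambda>w. measurement_mat n cs * (T * param_mat n es w * T) * excitation_mat n bs"
  assumes inv: "\<And>w k. w \<in> carrier_vec (length es) \<Longrightarrow> k < length es \<Longrightarrow>
      w $ k = (\<Sum>a<length cs. \<Sum>b<length bs. U k a b * Y w $$ (a, b))"
  shows "locally_identifiable_at n (set es) bs cs (param_mat n es x)"
proof -
  let ?M = "measurement_mat n cs" and ?B = "excitation_mat n bs" and ?G = "param_mat n es x"
  note M = measurement_mat_carrier[of n cs] and B = excitation_mat_carrier[of n bs]
  have det: "det (1\<^sub>m n - ?G) \<noteq> 0" using x by (simp add: admissible_def)
  have T: "T \<in> carrier_mat n n" unfolding T_def using det by (intro closed_loop) auto
  \<comment> \<open>The moduli of all coefficients of the left inverse together bound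
    \<open>param_mat n es w\<close> in terms of \<open>Y w\<close>.\<close>
  define \<kappa> where "\<kappa> = (\<Sum>k<length es. \<Sum>a<length cs. \<Sum>b<length bs. cmod (U k a b))"
  have \<kappa>0: "\<kappa> \<ge> 0" by (auto simp: \<kappa>_def intro!: sum_nonneg)
  have Ydim: "dim_row (Y w) = length cs" "dim_col (Y w) = length bs" for w
    using M B by (auto simp: Y_def)
  have bound: "sum_norm (param_mat n es w) \<le> \<kappa> * sum_norm (Y w)"
    if w: "w \<in> carrier_vec (length es)" for w
  proof -
    have "cmod (w $ k) \<le> (\<Sum>a<length cs. \<Sum>b<length bs. cmod (U k a b)) * sum_norm (Y w)"
      if k: "k < length es" for k
    proof -
      have "cmod (w $ k) \<le> (\<Sum>a<length cs. \<Sum>b<length bs. cmod (U k a b * Y w $$ (a, b)))"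
        unfolding inv[OF w k] by (intro order_trans[OF norm_sum] sum_mono norm_sum)
      also have "\<dots> \<le> (\<Sum>a<length cs. \<Sum>b<length bs. cmod (U k a b) * sum_norm (Y w))"
        unfolding norm_mult by (intro sum_mono mult_left_mono sum_norm_entry) (auto simp: Ydim)
      finally show ?thesis by (simp add: sum_distrib_right)
    qed
    hence "(\<Sum>k<length es. cmod (w $ k)) \<le> \<kappa> * sum_norm (Y w)"
      unfolding \<kappa>_def sum_distrib_right[of _ _ "sum_norm (Y w)"]
      by (intro sum_mono) (auto simp: sum_distrib_right)
    thus ?thesis using sum_norm_param_mat_le[OF es, of w] by simp
  qed
  define t where "t = sum_norm T"
  \<comment> \<open>\<open>\<kappa>\<close> times the bound on the measured remainder, with its two
    factors \<open>d\<close> taken out and \<open>T'\<close> estimated by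
    \<open>2 * t\<close>.\<close>
  define L where "L = \<kappa> * (sum_norm ?M * (t * (2 * t * t)) * sum_norm ?B)"
  have t0: "t \<ge> 0" by (simp add: t_def sum_norm_nonneg)
  have L0: "L \<ge> 0" using \<kappa>0 t0 by (simp add: L_def sum_norm_nonneg)
  \<comment> \<open>One radius for two purposes: \<open>\<eta> * t \<le> 1 / 2\<close> yields the
    bound on \<open>T'\<close>, and \<open>L * \<eta> \<le> 1 / 2\<close> turns the quadratic
    estimate into a contraction.\<close>
  define \<eta> where "\<eta> = 1 / (2 * (1 + t + L))"
  have \<eta>: "\<eta> > 0" "\<eta> * t \<le> 1 / 2" "L * \<eta> \<le> 1 / 2"
    using t0 L0 by (auto simp: \<eta>_def field_simps add_pos_nonneg)
  \<comment> \<open>Frobenius distance below \<open>\<epsilon>\<close> implies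
    \<open>sum_norm\<close> distance at most \<open>\<eta>\<close>; the added 1 covers
    \<open>n = 0\<close>.\<close>
  define \<epsilon> where "\<epsilon> = \<eta> / (real (n * n) + 1)"
  have \<epsilon>: "\<epsilon> > 0" using \<eta> by (simp add: \<epsilon>_def add_nonneg_pos)
  show ?thesis
    unfolding locally_identifiable_at_def
  proof (intro exI[of _ \<epsilon>] conjI allI impI \<epsilon>)
    fix G' assume net: "network_matrix n (set es) G'" and close: "frobenius_norm (G' - ?G) < \<epsilon>"
      and eq: "?M * closed_loop n G' * ?B = ?M * closed_loop n ?G * ?B"
    have cons: "consistent n (set es) G'" and det': "det (1\<^sub>m n - G') \<noteq> 0"
      using net by (auto simp: network_matrix_iff)
    have G': "G' \<in> carrier_mat n n" using cons by (simp add: consistent_def)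
    define T' where "T' = closed_loop n G'"
    have T': "T' \<in> carrier_mat n n" unfolding T'_def by (rule closed_loop(1)[OF G' det'])
    obtain x' where x': "x' \<in> carrier_vec (length es)" "G' = param_mat n es x'"
      using consistent_imp_param_mat[OF dist es cons] by blast
    define w where "w = x' - x"
    have xc: "x \<in> carrier_vec (length es)" using x by (simp add: admissible_def)
    have w: "w \<in> carrier_vec (length es)" using x' xc by (simp add: w_def)
    define D where "D = G' - ?G"
    have D: "D = param_mat n es w" using param_mat_diff[OF x'(1) xc] by (simp add: D_def w_def x'(2))
    have Dc: "D \<in> carrier_mat n n" by (simp add: D)
    define d where "d = sum_norm D"
    have d0: "d \<ge> 0" by (simp add: d_def sum_norm_nonneg)
    have d\<eta>: "d \<le> \<eta>"
    proof -
      have "d \<le> real (n * n) * frobenius_norm D"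
        using sum_norm_le_frobenius[of D] by (simp add: d_def D)
      also have "\<dots> \<le> (real (n * n) + 1) * \<epsilon>"
        using close \<epsilon> by (intro mult_mono) (auto simp: D_def frobenius_norm_def sum_nonneg)
      also have "\<dots> = \<eta>"
        using add_nonneg_pos[of "real (n * n)" 1] by (simp only: \<epsilon>_def) simp
      finally show ?thesis .
    qed
    have tT': "sum_norm T' \<le> 2 * t"
      unfolding T'_def t_def T_def
    proof (rule sum_norm_closed_loop_le)
      show "sum_norm (G' - ?G) * sum_norm (closed_loop n ?G) \<le> 1 / 2"
        using mult_right_mono[OF d\<eta> t0] \<eta>(2) by (simp add: d_def D_def t_def T_def)
    qed (use det det' G' in auto)
    define R where "R = T * D * (T' * D * T)"
    have Rc: "R \<in> carrier_mat n n" unfolding R_def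
      by (intro mult_carrier_mat[where n = n] T T' Dc)
    have Rn: "sum_norm R \<le> t * d * (2 * t * d * t)"
    proof -
      have 1: "sum_norm (T * D) \<le> t * d"
        unfolding t_def d_def by (rule sum_norm_mult[OF T Dc])
      have "sum_norm (T' * D) \<le> sum_norm T' * d"
        unfolding d_def by (rule sum_norm_mult[OF T' Dc])
      also have "\<dots> \<le> 2 * t * d" using tT' d0 by (intro mult_right_mono)
      finally have 2: "sum_norm (T' * D) \<le> 2 * t * d" .
      have "sum_norm (T' * D * T) \<le> sum_norm (T' * D) * t"
        unfolding t_def using T T' Dc by (intro sum_norm_mult[where nr = n and n = n and nc = n]) auto
      also have "\<dots> \<le> 2 * t * d * t" using 2 t0 by (intro mult_right_mono)
      finally have 3: "sum_norm (T' * D * T) \<le> 2 * t * d * t" .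
      have "sum_norm R \<le> sum_norm (T * D) * sum_norm (T' * D * T)"
        unfolding R_def using T T' Dc by (intro sum_norm_mult[where nr = n and n = n and nc = n]) auto
      also have "\<dots> \<le> t * d * (2 * t * d * t)"
        using 1 3 t0 d0 by (intro mult_mono) (auto simp: sum_norm_nonneg)
      finally show ?thesis .
    qed
    have T'eq: "T' = T + T * D * T + R"
      using resolvent_second_order[OF _ det G' det'] by (simp add: T'_def T_def D_def R_def)
    \<comment> \<open>After subtracting the equal responses, the first-order term and the remainder
      cancel in all measured entries.\<close>
    have "Y w = - (?M * R * ?B)"
    proof (rule eq_matI)
      fix a b assume "a < dim_row (- (?M * R * ?B))" "b < dim_col (- (?M * R * ?B))"
      hence ab: "a < length cs" "b < length bs" using M B by auto
      note can = nth_less_bound[OF cs ab(1)] and bbn = nth_less_bound[OF bs ab(2)]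
      have "(?M * T' * ?B) $$ (a, b) = (?M * T * ?B) $$ (a, b)"
        using eq by (simp add: T'_def T_def)
      hence "T' $$ (cs ! a, bs ! b) = T $$ (cs ! a, bs ! b)"
        unfolding measurement_excitation[OF T' bs cs] measurement_excitation[OF T bs cs]
        using ab by simp
      moreover have "T' $$ (cs ! a, bs ! b) = T $$ (cs ! a, bs ! b)
          + (T * D * T) $$ (cs ! a, bs ! b) + R $$ (cs ! a, bs ! b)"
        unfolding T'eq using can bbn T Dc Rc by (simp del: index_mult_mat(1))
      ultimately have *: "(T * D * T) $$ (cs ! a, bs ! b) = - R $$ (cs ! a, bs ! b)"
        by (simp add: add_eq_0_iff2)
      have TDT: "T * D * T \<in> carrier_mat n n" using T Dc by simp
      have MR: "?M * R * ?B \<in> carrier_mat (length cs) (length bs)" using M B Rc by simp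
      have "(- (?M * R * ?B)) $$ (a, b) = - (?M * R * ?B) $$ (a, b)"
        using MR ab by (intro index_uminus_mat) auto
      thus "Y w $$ (a, b) = (- (?M * R * ?B)) $$ (a, b)"
        unfolding Y_def D[symmetric] measurement_excitation[OF TDT bs cs]
          measurement_excitation[OF Rc bs cs] using ab * by simp
    qed (use M B in \<open>auto simp: Ydim\<close>)
    hence "sum_norm (Y w) = sum_norm (?M * R * ?B)"
      by (simp add: sum_norm_def del: index_mult_mat(1))
    also have "\<dots> \<le> sum_norm (?M * R) * sum_norm ?B"
      using M B Rc by (intro sum_norm_mult[where n = n and nr = "length cs" and nc = "length bs"]) auto
    also have "\<dots> \<le> sum_norm ?M * sum_norm R * sum_norm ?B"
      by (intro mult_right_mono sum_norm_mult[OF M Rc] sum_norm_nonneg)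
    also have "\<dots> \<le> sum_norm ?M * (t * d * (2 * t * d * t)) * sum_norm ?B"
      using Rn by (intro mult_right_mono mult_left_mono sum_norm_nonneg)
    finally have "\<kappa> * sum_norm (Y w)
        \<le> \<kappa> * (sum_norm ?M * (t * d * (2 * t * d * t)) * sum_norm ?B)"
      using \<kappa>0 by (rule mult_left_mono)
    also have "\<dots> = L * d * d" by (simp add: L_def algebra_simps)
    also have "\<dots> \<le> L * \<eta> * d" using d\<eta> d0 L0 by (intro mult_right_mono mult_left_mono)
    also have "\<dots> \<le> 1 / 2 * d" using \<eta>(3) d0 by (intro mult_right_mono)
    finally have "d \<le> 0" using bound[OF w] d0 by (simp add: d_def D)
    show "G' = ?G"
    proof (rule eq_matI)
      fix i j assume "i < dim_row ?G" "j < dim_col ?G"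
      hence ij: "i < n" "j < n" by auto
      have "cmod (D $$ (i, j)) \<le> d" unfolding d_def using ij Dc by (intro sum_norm_entry) auto
      hence "D $$ (i, j) = 0" using \<open>d \<le> 0\<close> by (metis norm_le_zero_iff order_trans)
      thus "G' $$ (i, j) = ?G $$ (i, j)" using ij G' by (simp add: D_def)
    qed (use G' in auto)
  qed
qed

text \<open>Bolzano-Weierstrass: a monotone subsequence settles the real case, which is applied to
  the real parts and then, along that subsequence, to the imaginary parts.\<close>

lemma Bseq_convergent_subseq_complex:
  fixes X :: "nat \<Rightarrow> complex"
  assumes "Bseq X"
  shows "\<exists>r. strict_mono r \<and> convergent (X \<circ> r)"
proof -
  have real: "\<exists>r :: nat \<Rightarrow> nat. strict_mono r \<and> convergent (Z \<circ> r)" if "Bseq Z" for Z :: "nat \<Rightarrow> real"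
  proof -
    obtain r :: "nat \<Rightarrow> nat" where r: "strict_mono r" "monoseq (\<lambda>n. Z (r n))"
      using seq_monosub by blast
    have "Bseq (\<lambda>n. Z (r n))" using that by (rule Bseq_subseq)
    thus ?thesis using r Bseq_monoseq_convergent by (auto simp: o_def)
  qed
  obtain K where K: "\<And>n. cmod (X n) \<le> K" using assms by (auto simp: Bseq_def)
  have "Bseq (\<lambda>n. Re (X n))"
    by (rule BseqI'[of _ K]) (simp add: order_trans[OF abs_Re_le_cmod K])
  then obtain r :: "nat \<Rightarrow> nat" where r: "strict_mono r" "convergent (\<lambda>n. Re (X (r n)))"
    using real by (auto simp: o_def)
  have "Bseq (\<lambda>n. Im (X (r n)))"
    by (rule BseqI'[of _ K]) (simp add: order_trans[OF abs_Im_le_cmod K])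
  then obtain s :: "nat \<Rightarrow> nat" where s: "strict_mono s" "convergent (\<lambda>n. Im (X (r (s n))))"
    using real by (auto simp: o_def)
  obtain l where "(\<lambda>n. Re (X (r n))) \<longlonglongrightarrow> l" using r(2) by (auto simp: convergent_def)
  hence re: "(\<lambda>n. Re (X (r (s n)))) \<longlonglongrightarrow> l"
    using LIMSEQ_subseq_LIMSEQ[OF _ s(1)] by (fastforce simp: o_def)
  obtain l' where im: "(\<lambda>n. Im (X (r (s n)))) \<longlonglongrightarrow> l'" using s(2) by (auto simp: convergent_def)
  have "(\<lambda>n. X (r (s n))) \<longlonglongrightarrow> Complex l l'"
    using tendsto_Complex[OF re im] by simp
  thus ?thesis using strict_mono_o[OF r(1) s(1)]
    by (intro exI[of _ "r \<circ> s"]) (auto simp: convergent_def o_def)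
qed

text \<open>The sequence is thinned out once per coordinate; coordinates that already converge keep
  converging under further thinning.\<close>

lemma bounded_vec_convergent_subseq:
  fixes Y :: "nat \<Rightarrow> complex vec"
  assumes "\<And>j. j < m \<Longrightarrow> Bseq (\<lambda>n. Y n $ j)"
  shows "\<exists>r l. strict_mono r \<and> l \<in> carrier_vec m \<and> (\<forall>j<m. (\<lambda>n. Y (r n) $ j) \<longlonglongrightarrow> l $ j)"
proof -
  have "\<exists>r. strict_mono r \<and> (\<forall>j<c. convergent (\<lambda>n. Y (r n) $ j))" if "c \<le> m" for c
    using that
  proof (induction c)
    case 0
    show ?case by (rule exI[of _ id]) (auto simp: strict_mono_def)
  next
    case (Suc c)
    then obtain r where r: "strict_mono r" "\<forall>j<c. convergent (\<lambda>n. Y (r n) $ j)" by auto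
    have "Bseq (\<lambda>n. Y (r n) $ c)"
      using assms[of c] Suc.prems r(1) Bseq_subseq[of "\<lambda>n. Y n $ c" r] by simp
    then obtain s :: "nat \<Rightarrow> nat" where s: "strict_mono s" "convergent (\<lambda>n. Y (r (s n)) $ c)"
      using Bseq_convergent_subseq_complex by (auto simp: o_def)
    have "convergent (\<lambda>n. Y (r (s n)) $ j)" if "j < c" for j
      using convergent_subseq_convergent[OF r(2)[rule_format, OF that] s(1)] by (simp add: o_def)
    thus ?case using s strict_mono_o[OF r(1) s(1)]
      by (intro exI[of _ "r \<circ> s"]) (auto simp: less_Suc_eq o_def)
  qed
  then obtain r where r: "strict_mono r" "\<forall>j<m. convergent (\<lambda>n. Y (r n) $ j)" by blast
  let ?l = "vec m (\<lambda>j. lim (\<lambda>n. Y (r n) $ j))"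
  have "\<forall>j<m. (\<lambda>n. Y (r n) $ j) \<longlonglongrightarrow> ?l $ j"
    using r(2) by (simp add: convergent_LIMSEQ_iff)
  thus ?thesis using r(1) by (intro exI[of _ r] exI[of _ ?l]) auto
qed

text \<open>Moving along \<open>V\<close> by a step of length \<open>h\<close> changes the measured response only by \<open>O(h\<^sup>2)\<close>, because
  its first-order change vanishes. So a polygon of \<open>N\<close> steps of length \<open>\<delta> / N\<close> stays away from \<open>x0\<close>
  and changes the response by \<open>O(1 / N)\<close>, and a limit point of the end points has the response of
  \<open>x0\<close>.\<close>

lemma not_locally_identifiable_if_kernel_field:
  fixes v :: "nat \<Rightarrow> complex vec \<Rightarrow> complex"
  assumes x0: "x0 \<in> admissible n es"
    and dist: "distinct es" and es: "set es \<subseteq> {..<n} \<times> {..<n}"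
    and bs: "set bs \<subseteq> {..<n}" and cs: "set cs \<subseteq> {..<n}"
    and detpoly: "poly_fun {..<length es} (\<lambda>x. det (1\<^sub>m n - param_mat n es x))"
    and v: "\<And>j. j < length es \<Longrightarrow> poly_fun {..<length es} (v j)"
    and j0: "j0 < length es" and nz: "v j0 x0 \<noteq> 0"
  defines "T \<equiv> \<lambda>x. closed_loop n (param_mat n es x)"
    and "V \<equiv> \<lambda>x. vec (length es) (\<lambda>j. v j x)"
  assumes ker: "\<And>x. x \<in> admissible n es \<Longrightarrow>
      measurement_mat n cs * (T x * param_mat n es (V x) * T x) * excitation_mat n bs
        = 0\<^sub>m (length cs) (length bs)"
  shows "\<not> locally_identifiable_at n (set es) bs cs (param_mat n es x0)"
proof
  assume "locally_identifiable_at n (set es) bs cs (param_mat n es x0)"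
  then obtain \<epsilon> where \<epsilon>: "\<epsilon> > 0"
    and ident: "\<And>G'. network_matrix n (set es) G' \<Longrightarrow> frobenius_norm (G' - param_mat n es x0) < \<epsilon> \<Longrightarrow>
        measurement_mat n cs * closed_loop n G' * excitation_mat n bs =
        measurement_mat n cs * T x0 * excitation_mat n bs \<Longrightarrow> G' = param_mat n es x0"
    unfolding locally_identifiable_at_def T_def by blast
  define m where "m = length es"
  let ?G = "param_mat n es"
  have adm: "x \<in> admissible n es \<longleftrightarrow> x \<in> carrier_vec m \<and> det (1\<^sub>m n - ?G x) \<noteq> 0" for x
    by (auto simp: admissible_def m_def)
  have x0c: "x0 \<in> carrier_vec m" and det0: "det (1\<^sub>m n - ?G x0) \<noteq> 0" using x0 by (auto simp: adm)
  have T: "T x \<in> carrier_mat n n" if "x \<in> admissible n es" for x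
    unfolding T_def using that by (intro closed_loop) (auto simp: adm)
  define t where "t = sum_norm (T x0)"
  have t0: "t \<ge> 0" by (simp add: t_def sum_norm_nonneg)
  define s where "s = cmod (v j0 x0)"
  have s0: "s > 0" using nz by (simp add: s_def)
  \<comment> \<open>Closeness within \<open>e\<close> keeps the determinant nonzero. It also keeps
    \<open>v j0\<close> within \<open>s / 2\<close> of a value of modulus \<open>s\<close>, so the
    motion cannot turn back.\<close>
  define e where "e = min (cmod (det (1\<^sub>m n - ?G x0))) (s / 2)"
  have e0: "e > 0" using det0 s0 by (simp add: e_def)
  obtain \<delta>0 where \<delta>0: "\<delta>0 > 0" "\<And>x. \<forall>i\<in>{..<m}. cmod (x $ i - x0 $ i) \<le> \<delta>0 \<Longrightarrow>
      \<forall>f\<in>insert (\<lambda>x. det (1\<^sub>m n - ?G x)) (v ` {..<m}). cmod (f x - f x0) < e"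
    using poly_fun_continuous_finite[of "insert (\<lambda>x. det (1\<^sub>m n - ?G x)) (v ` {..<m})" "{..<m}" e x0]
      detpoly v e0 by (auto simp: m_def)
  \<comment> \<open>The three bounds serve, in turn, continuity, the resolvent estimate
    \<open>real m * \<rho> * t \<le> 1 / 2\<close>, and distance less than
    \<open>\<epsilon>\<close>, which the summand 1 makes strict.\<close>
  define \<rho> where "\<rho> = min \<delta>0 (min (1 / (2 * (real m + 1) * (t + 1))) (\<epsilon> / (real m + 1)))"
  have \<rho>0: "\<rho> > 0" using \<delta>0 \<epsilon> t0 by (auto simp: \<rho>_def add_nonneg_pos)
  have \<rho>t: "real m * \<rho> * t \<le> 1 / 2"
  proof -
    define D where "D = (real m + 1) * (t + 1)"
    have "D > 0" using t0 by (simp add: D_def add_nonneg_pos)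
    moreover have "\<rho> \<le> 1 / (2 * D)" 
      unfolding \<rho>_def D_def mult.assoc by (rule min.coboundedI2, rule min.cobounded1)
    ultimately have "\<rho> * D \<le> 1 / 2" by (simp add: field_simps)
    moreover have "\<rho> * (real m * t) \<le> \<rho> * D"
      using \<rho>0 t0 by (intro mult_left_mono) (auto simp: D_def algebra_simps)
    moreover have "real m * \<rho> * t = \<rho> * (real m * t)" by simp
    ultimately show ?thesis by linarith
  qed
  have \<rho>\<epsilon>: "real m * \<rho> < \<epsilon>"
  proof -
    have "\<rho> \<le> \<epsilon> / (real m + 1)" by (simp add: \<rho>_def)
    hence "\<rho> * (real m + 1) \<le> \<epsilon>" by (simp add: field_simps)
    thus ?thesis using \<rho>0 by (simp add: algebra_simps)
  qed
  \<comment> \<open>The box is closed, so it will contain the limit of the end points.\<close>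
  define box where "box = {x \<in> carrier_vec m. \<forall>i<m. cmod (x $ i - x0 $ i) \<le> \<rho>}"
  have near: "\<forall>f\<in>insert (\<lambda>x. det (1\<^sub>m n - ?G x)) (v ` {..<m}). cmod (f x - f x0) < e"
    if "x \<in> box" for x
    using that by (intro \<delta>0(2)) (auto simp: box_def \<rho>_def)
  have box_adm: "x \<in> admissible n es" if "x \<in> box" for x
    using near[OF that] that by (auto simp: adm box_def e_def)
  have box_v: "cmod (v j x - v j x0) \<le> s / 2" if "x \<in> box" "j < m" for x j
    using near[OF that(1)] that(2) by (auto simp: e_def less_imp_le)
  have G_diff: "sum_norm (?G y - ?G x) \<le> (\<Sum>i<m. cmod (y $ i - x $ i))"
    if "x \<in> carrier_vec m" "y \<in> carrier_vec m" for x y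
    using sum_norm_param_mat_le[OF es, of "y - x"] param_mat_diff[of y es x n] that
    by (simp add: m_def)
  have box_sum: "(\<Sum>i<m. cmod (x $ i - x0 $ i)) \<le> real m * \<rho>" if "x \<in> box" for x
    using sum_bounded_above[of "{..<m}" "\<lambda>i. cmod (x $ i - x0 $ i)" \<rho>] that by (simp add: box_def)
  define \<tau> where "\<tau> = 2 * t"
  have \<tau>0: "\<tau> \<ge> 0" using t0 by (simp add: \<tau>_def)
  have box_T: "sum_norm (T x) \<le> \<tau>" if x: "x \<in> box" for x
    unfolding T_def \<tau>_def t_def
  proof (rule sum_norm_closed_loop_le)
    have "sum_norm (?G x - ?G x0) \<le> real m * \<rho>"
      using G_diff[OF x0c, of x] box_sum[OF x] x by (auto simp: box_def)
    thus "sum_norm (?G x - ?G x0) * sum_norm (closed_loop n (?G x0)) \<le> 1 / 2"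
      using \<rho>t mult_right_mono[of _ _ t] t0 by (fastforce simp: t_def T_def)
  qed (use x0 box_adm[OF x] in \<open>auto simp: adm\<close>)
  \<comment> \<open>A bound for the speed: on the box, \<open>V\<close> has l1 norm at most
    \<open>M\<close>.\<close>
  define M where "M = (\<Sum>j<m. cmod (v j x0) + s / 2)"
  have M: "(\<Sum>j<m. cmod (V x $ j)) \<le> M" if "x \<in> box" for x
    unfolding M_def
  proof (rule sum_mono)
    fix j assume "j \<in> {..<m}"
    hence j: "j < m" by simp
    have "cmod (v j x) \<le> cmod (v j x0) + cmod (v j x - v j x0)"
      using norm_triangle_ineq[of "v j x0" "v j x - v j x0"] by simp
    thus "cmod (V x $ j) \<le> cmod (v j x0) + s / 2"
      using box_v[OF that j] j by (simp add: V_def m_def)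
  qed
  have M0: "M > 0"
    unfolding M_def using j0 s0 by (intro sum_pos) (auto simp: m_def add_nonneg_pos)
  have Vj: "cmod (V x $ j) \<le> M" if "x \<in> box" "j < m" for x j
    using member_le_sum[of j "{..<m}" "\<lambda>j. cmod (V x $ j)"] M[OF that(1)] that(2) by simp
  have Vc: "V x \<in> carrier_vec m" for x by (simp add: V_def m_def)
  \<comment> \<open>The remainder of a step of length \<open>h\<close> is at most
    \<open>h * h * K\<close>: each factor \<open>D\<close> contributes \<open>h * M\<close>, each
    resolvent \<open>\<tau>\<close>.\<close>
  define K where "K = \<tau> * M * (\<tau> * M * \<tau>)"
  have K0: "K \<ge> 0" using \<tau>0 M0 by (simp add: K_def)
  have step: "cmod (T (x + complex_of_real h \<cdot>\<^sub>v V x) $$ (cs ! a, bs ! b) - T x $$ (cs ! a, bs ! b)) \<le> h * h * K"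
    if x: "x \<in> box" and x': "x + complex_of_real h \<cdot>\<^sub>v V x \<in> box" and h: "h \<ge> 0"
      and a: "a < length cs" and b: "b < length bs" for x h a b
  proof -
    let ?x' = "x + complex_of_real h \<cdot>\<^sub>v V x"
    note can = nth_less_bound[OF cs a] and bbn = nth_less_bound[OF bs b]
    have xc: "x \<in> carrier_vec m" using x by (simp add: box_def)
    note Tx = T[OF box_adm[OF x]] and Tx' = T[OF box_adm[OF x']]
    define D where "D = ?G ?x' - ?G x"
    have "?x' - x = complex_of_real h \<cdot>\<^sub>v V x"
      using xc Vc[of x] by (auto intro!: eq_vecI)
    hence D: "D = complex_of_real h \<cdot>\<^sub>m ?G (V x)"
      unfolding D_def using xc Vc[of x]
      by (subst param_mat_diff) (auto simp: m_def param_mat_smult)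
    have Dc: "D \<in> carrier_mat n n" by (simp add: D)
    have Dn: "sum_norm D \<le> h * M"
    proof -
      have "sum_norm D \<le> (\<Sum>i<m. cmod (?x' $ i - x $ i))"
        unfolding D_def using xc Vc[of x] by (intro G_diff) auto
      also have "\<dots> = (\<Sum>i<m. h * cmod (V x $ i))"
        using xc Vc[of x] h by (intro sum.cong) (auto simp: norm_mult)
      also have "\<dots> \<le> h * M" using M[OF x] h by (simp add: sum_distrib_left[symmetric] mult_left_mono)
      finally show ?thesis .
    qed
    let ?R = "T x * D * (T ?x' * D * T x)"
    have Rc: "?R \<in> carrier_mat n n" by (intro mult_carrier_mat[where n = n] Tx Tx' Dc)
    have TDT: "T x * D * T x = complex_of_real h \<cdot>\<^sub>m (T x * ?G (V x) * T x)"
      unfolding D using Tx mult_smult_distrib[OF Tx param_mat_carrier]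
        mult_smult_assoc_mat[of "T x * ?G (V x)" n n "T x" n] by simp
    have X: "T x * ?G (V x) * T x \<in> carrier_mat n n"
      by (intro mult_carrier_mat[where n = n] Tx param_mat_carrier)
    have "(measurement_mat n cs * (T x * ?G (V x) * T x) * excitation_mat n bs) $$ (a, b) = 0"
      using ker[OF box_adm[OF x]] a b by simp
    hence "(T x * ?G (V x) * T x) $$ (cs ! a, bs ! b) = 0"
      unfolding measurement_excitation[OF X bs cs] using a b by simp
    hence 0: "(T x * D * T x) $$ (cs ! a, bs ! b) = 0"
      unfolding TDT using X can bbn by (simp del: index_mult_mat)
    have "T ?x' = T x + T x * D * T x + ?R"
      unfolding T_def D_def using box_adm[OF x] box_adm[OF x']
      by (intro resolvent_second_order) (auto simp: adm)
    hence "T ?x' $$ (cs ! a, bs ! b) = (T x + T x * D * T x + ?R) $$ (cs ! a, bs ! b)"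
      by (rule arg_cong)
    also have "\<dots> = T x $$ (cs ! a, bs ! b) + (T x * D * T x) $$ (cs ! a, bs ! b) + ?R $$ (cs ! a, bs ! b)"
      by (intro index_add_add_mat[where nr = n and nc = n] mult_carrier_mat[where n = n] Tx Tx' Dc can bbn)
    finally have "cmod (T ?x' $$ (cs ! a, bs ! b) - T x $$ (cs ! a, bs ! b)) = cmod (?R $$ (cs ! a, bs ! b))"
      unfolding 0 by simp
    also have "\<dots> \<le> sum_norm ?R" using Rc can bbn by (intro sum_norm_entry) auto
    also have "\<dots> \<le> sum_norm (T x * D) * sum_norm (T ?x' * D * T x)"
      using Tx Tx' Dc by (intro sum_norm_mult[where nr = n and n = n and nc = n]) auto
    also have "\<dots> \<le> \<tau> * (h * M) * (\<tau> * (h * M) * \<tau>)"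
    proof (intro mult_mono sum_norm_nonneg)
      have bound: "sum_norm (T y * D) \<le> \<tau> * (h * M)" if y: "y \<in> box" for y
        using sum_norm_mult[OF T[OF box_adm[OF y]] Dc] mult_mono[OF box_T[OF y] Dn \<tau>0 sum_norm_nonneg]
        by simp
      thus "sum_norm (T x * D) \<le> \<tau> * (h * M)" using x .
      have "sum_norm (T ?x' * D * T x) \<le> sum_norm (T ?x' * D) * sum_norm (T x)"
        using Tx Tx' Dc by (intro sum_norm_mult[where nr = n and n = n and nc = n]) auto
      also have "\<dots> \<le> \<tau> * (h * M) * \<tau>"
        using bound[OF x'] box_T[OF x] \<tau>0 h M0 by (intro mult_mono) (auto simp: sum_norm_nonneg)
      finally show "sum_norm (T ?x' * D * T x) \<le> \<tau> * (h * M) * \<tau>" .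
    qed (use \<tau>0 h M0 in auto)
    also have "\<dots> = h * h * K" by (simp add: K_def)
    finally show ?thesis .
  qed
  \<comment> \<open>The total time: at speed at most \<open>M\<close>, a path of this duration stays
    within \<open>\<rho>\<close> of \<open>x0\<close>.\<close>
  define \<delta> where "\<delta> = \<rho> / M"
  have \<delta>: "\<delta> > 0" "\<delta> * M = \<rho>" using \<rho>0 M0 by (auto simp: \<delta>_def)
  define X where "X h k = ((\<lambda>x. x + complex_of_real h \<cdot>\<^sub>v V x) ^^ k) x0" for h k
  \<comment> \<open>Besides the box, the induction tracks two accumulating errors: coordinate
    \<open>j0\<close> deviates from uniform motion at velocity \<open>v j0 x0\<close> by at most
    half of the distance covered, and each step changes the response by at most
    \<open>h * h * K\<close>.\<close>
  have poly: "X h k \<in> carrier_vec m \<and> (\<forall>i<m. cmod (X h k $ i - x0 $ i) \<le> real k * h * M) \<and>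
      cmod (X h k $ j0 - x0 $ j0 - complex_of_real (real k * h) * v j0 x0) \<le> real k * h * (s / 2) \<and>
      (\<forall>a<length cs. \<forall>b<length bs.
        cmod (T (X h k) $$ (cs ! a, bs ! b) - T x0 $$ (cs ! a, bs ! b)) \<le> real k * (h * h * K))"
    if h: "h > 0" "real k * h \<le> \<delta>" for h k
    using h(2)
  proof (induction k)
    case 0
    show ?case using x0c by (simp add: X_def)
  next
    case (Suc k)
    have kh: "real k * h \<le> real (Suc k) * h" using h by (intro mult_right_mono) auto
    note IH = Suc.IH[OF order_trans[OF kh Suc.prems]]
    define x where "x = X h k"
    have Suc_x: "X h (Suc k) = x + complex_of_real h \<cdot>\<^sub>v V x" by (simp add: X_def x_def)
    have in_box: "z \<in> box"
      if "z \<in> carrier_vec m" "real l * h \<le> \<delta>" "\<forall>i<m. cmod (z $ i - x0 $ i) \<le> real l * h * M" for z l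
    proof -
      have "real l * h * M \<le> \<rho>" using mult_right_mono[OF that(2) less_imp_le[OF M0]] \<delta>(2) by simp
      thus ?thesis using that(1,3) by (auto simp: box_def intro: order_trans)
    qed
    have xc: "x \<in> carrier_vec m" using IH by (simp add: x_def)
    have xb: "x \<in> box"
      using IH order_trans[OF kh Suc.prems] xc by (intro in_box[of x k]) (auto simp: x_def)
    have c1: "X h (Suc k) \<in> carrier_vec m" using xc Vc[of x] by (simp add: Suc_x)
    have idx: "X h (Suc k) $ i = x $ i + complex_of_real h * V x $ i" if "i < m" for i
      using that xc Vc[of x] by (simp add: Suc_x)
    have c2: "\<forall>i<m. cmod (X h (Suc k) $ i - x0 $ i) \<le> real (Suc k) * h * M"
    proof (intro allI impI)
      fix i assume i: "i < m"
      have "cmod (X h (Suc k) $ i - x0 $ i) \<le> cmod (x $ i - x0 $ i) + cmod (complex_of_real h * V x $ i)"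
        using norm_triangle_ineq[of "x $ i - x0 $ i" "complex_of_real h * V x $ i"]
        by (simp add: idx[OF i] algebra_simps)
      also have "cmod (complex_of_real h * V x $ i) \<le> h * M"
        using Vj[OF xb i] h by (simp add: norm_mult)
      also have "cmod (x $ i - x0 $ i) \<le> real k * h * M" using IH i by (simp add: x_def)
      finally show "cmod (X h (Suc k) $ i - x0 $ i) \<le> real (Suc k) * h * M"
        by (simp add: algebra_simps)
    qed
    have x'b: "X h (Suc k) \<in> box" using c1 Suc.prems c2 by (rule in_box)
    have c3: "cmod (X h (Suc k) $ j0 - x0 $ j0 - complex_of_real (real (Suc k) * h) * v j0 x0)
        \<le> real (Suc k) * h * (s / 2)"
    proof -
      have j0m: "j0 < m" using j0 by (simp add: m_def)
      have "X h (Suc k) $ j0 - x0 $ j0 - complex_of_real (real (Suc k) * h) * v j0 x0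
          = (x $ j0 - x0 $ j0 - complex_of_real (real k * h) * v j0 x0)
            + complex_of_real h * (v j0 x - v j0 x0)"
        using j0 by (simp add: idx[OF j0m] V_def algebra_simps)
      hence "cmod (X h (Suc k) $ j0 - x0 $ j0 - complex_of_real (real (Suc k) * h) * v j0 x0)
          \<le> cmod (x $ j0 - x0 $ j0 - complex_of_real (real k * h) * v j0 x0)
            + cmod (complex_of_real h * (v j0 x - v j0 x0))"
        by (simp only: norm_triangle_ineq)
      also have "cmod (complex_of_real h * (v j0 x - v j0 x0)) \<le> h * (s / 2)"
        using box_v[OF xb j0m] h by (simp only: norm_mult norm_of_real) (simp add: mult_left_mono)
      also have "cmod (x $ j0 - x0 $ j0 - complex_of_real (real k * h) * v j0 x0) \<le> real k * h * (s / 2)"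
        using IH by (simp add: x_def)
      finally show ?thesis by (simp add: algebra_simps)
    qed
    have c4: "\<forall>a<length cs. \<forall>b<length bs.
        cmod (T (X h (Suc k)) $$ (cs ! a, bs ! b) - T x0 $$ (cs ! a, bs ! b)) \<le> real (Suc k) * (h * h * K)"
    proof (intro allI impI)
      fix a b assume ab: "a < length cs" "b < length bs"
      let ?e = "\<lambda>y. T y $$ (cs ! a, bs ! b)"
      have "cmod (?e (X h (Suc k)) - ?e x0) \<le> cmod (?e (X h (Suc k)) - ?e x) + cmod (?e x - ?e x0)"
        using norm_triangle_ineq[of "?e (X h (Suc k)) - ?e x" "?e x - ?e x0"] by simp
      also have "cmod (?e (X h (Suc k)) - ?e x) \<le> h * h * K"
        unfolding Suc_x using xb x'b h ab by (intro step) (auto simp: Suc_x)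
      also have "cmod (?e x - ?e x0) \<le> real k * (h * h * K)" using IH ab by (simp add: x_def)
      finally show "cmod (?e (X h (Suc k)) - ?e x0) \<le> real (Suc k) * (h * h * K)"
        by (simp add: algebra_simps)
    qed
    show ?case using c1 c2 c3 c4 by blast
  qed
  define Y where "Y N = X (\<delta> / real (Suc N)) (Suc N)" for N
  have Yh: "real (Suc N) * (\<delta> / real (Suc N)) = \<delta>" for N by simp
  have Ybox: "Y N \<in> box" for N
    using poly[of "\<delta> / real (Suc N)" "Suc N"] \<delta> by (simp add: Y_def box_def del: of_nat_Suc)
  \<comment> \<open>Uniform motion covers \<open>\<delta> * s\<close>, and the deviation is at most
    half of that. The bound does not depend on \<open>N\<close>, so it survives the limit.\<close>
  have Yj0: "cmod (Y N $ j0 - x0 $ j0) \<ge> \<delta> * (s / 2)" for N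
  proof -
    have "cmod (Y N $ j0 - x0 $ j0 - complex_of_real \<delta> * v j0 x0) \<le> \<delta> * (s / 2)"
      using poly[of "\<delta> / real (Suc N)" "Suc N"] \<delta>(1) unfolding Yh Y_def by simp
    moreover have "cmod (complex_of_real \<delta> * v j0 x0) = \<delta> * s"
      using \<delta>(1) by (simp add: norm_mult s_def)
    ultimately show ?thesis
      using norm_triangle_ineq3[of "Y N $ j0 - x0 $ j0" "complex_of_real \<delta> * v j0 x0"] by simp
  qed
  have YT: "cmod (T (Y N) $$ (cs ! a, bs ! b) - T x0 $$ (cs ! a, bs ! b)) \<le> \<delta> * \<delta> * K / real (Suc N)"
    if "a < length cs" "b < length bs" for N a b
  proof -
    have "real (Suc N) * (\<delta> / real (Suc N) * (\<delta> / real (Suc N)) * K) = \<delta> * \<delta> * K / real (Suc N)"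
      by (simp del: of_nat_Suc)
    thus ?thesis
      using poly[of "\<delta> / real (Suc N)" "Suc N"] \<delta>(1) that unfolding Yh Y_def by simp
  qed
  have "Bseq (\<lambda>N. Y N $ j)" if "j < m" for j
  proof (rule BseqI')
    fix N
    have "cmod (Y N $ j - x0 $ j) \<le> \<rho>" using Ybox[of N] that by (simp add: box_def)
    thus "cmod (Y N $ j) \<le> \<rho> + cmod (x0 $ j)"
      using norm_triangle_ineq[of "Y N $ j - x0 $ j" "x0 $ j"] by simp
  qed
  from bounded_vec_convergent_subseq[OF this] obtain r y where r: "strict_mono r"
    and yc: "y \<in> carrier_vec m" and lim: "\<And>j. j < m \<Longrightarrow> (\<lambda>N. Y (r N) $ j) \<longlonglongrightarrow> y $ j"
    by blast
  have lim0: "(\<lambda>N. cmod (Y (r N) $ j - x0 $ j)) \<longlonglongrightarrow> cmod (y $ j - x0 $ j)" if "j < m" for j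
    using lim[OF that] by (intro tendsto_intros)
  have ybox: "y \<in> box"
    unfolding box_def using yc Ybox
    by (auto simp: box_def intro!: LIMSEQ_le_const2[OF lim0])
  have "\<delta> * (s / 2) \<le> cmod (y $ j0 - x0 $ j0)"
    using j0 Yj0 by (intro LIMSEQ_le_const[OF lim0]) (auto simp: m_def)
  moreover have "0 < \<delta> * (s / 2)" using \<delta>(1) s0 by simp
  ultimately have y_neq: "y \<noteq> x0" by auto
  have Tyx: "T y $$ (cs ! a, bs ! b) = T x0 $$ (cs ! a, bs ! b)"
    if ab: "a < length cs" "b < length bs" for a b
  proof -
    note can = nth_less_bound[OF cs ab(1)] and bbn = nth_less_bound[OF bs ab(2)]
    let ?e = "\<lambda>y. T y $$ (cs ! a, bs ! b)"
    \<comment> \<open>The resolvent identity between the limit and an end point gives the first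
      summand, the drift of the response along the polygon the second. Both tend to 0.\<close>
    let ?B = "\<lambda>N. \<tau> * (\<Sum>j<m. cmod (y $ j - Y (r N) $ j)) * \<tau> + \<delta> * \<delta> * K / real (Suc (r N))"
    have bound: "cmod (?e y - ?e x0) \<le> ?B N" for N
    proof -
      define z where "z = Y (r N)"
      have zb: "z \<in> box" using Ybox by (simp add: z_def)
      hence zc: "z \<in> carrier_vec m" by (simp add: box_def)
      note Ty = T[OF box_adm[OF ybox]] and Tz = T[OF box_adm[OF zb]]
      define D where "D = ?G y - ?G z"
      have Dc: "D \<in> carrier_mat n n" by (simp add: D_def minus_carrier_mat)
      have "T y = T z + T y * D * T z"
        unfolding T_def D_def using box_adm[OF ybox] box_adm[OF zb]
        by (intro resolvent) (auto simp: adm)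
      hence "?e y = ?e z + (T y * D * T z) $$ (cs ! a, bs ! b)"
        using can bbn Ty Tz Dc
        by (metis carrier_matD index_add_mat(1) index_mult_mat(2,3))
      hence "cmod (?e y - ?e z) = cmod ((T y * D * T z) $$ (cs ! a, bs ! b))" by simp
      also have "\<dots> \<le> sum_norm (T y * D * T z)"
        using can bbn Ty Tz Dc by (intro sum_norm_entry) auto
      also have "\<dots> \<le> sum_norm (T y * D) * sum_norm (T z)"
        using Ty Tz Dc by (intro sum_norm_mult[where nr = n and n = n and nc = n]) auto
      also have "\<dots> \<le> sum_norm (T y) * sum_norm D * sum_norm (T z)"
        by (intro mult_right_mono sum_norm_mult[OF Ty Dc] sum_norm_nonneg)
      also have "\<dots> \<le> \<tau> * (\<Sum>j<m. cmod (y $ j - z $ j)) * \<tau>"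
        using box_T[OF ybox] box_T[OF zb] G_diff[OF zc yc] \<tau>0
        by (intro mult_mono) (auto simp: D_def sum_norm_nonneg sum_nonneg)
      finally have "cmod (?e y - ?e z) \<le> \<tau> * (\<Sum>j<m. cmod (y $ j - z $ j)) * \<tau>" .
      moreover have "cmod (?e y - ?e x0) \<le> cmod (?e y - ?e z) + cmod (?e z - ?e x0)"
        using norm_triangle_ineq[of "?e y - ?e z" "?e z - ?e x0"] by simp
      ultimately show ?thesis using YT[OF ab, of "r N"] unfolding z_def by linarith
    qed
    have "(\<lambda>N. cmod (y $ j - Y (r N) $ j)) \<longlonglongrightarrow> cmod (y $ j - y $ j)" if "j < m" for j
      using lim[OF that] by (intro tendsto_intros)
    hence "(\<lambda>N. \<Sum>j<m. cmod (y $ j - Y (r N) $ j)) \<longlonglongrightarrow> (\<Sum>j<m. 0)"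
      by (intro tendsto_sum) auto
    hence 1: "(\<lambda>N. \<tau> * (\<Sum>j<m. cmod (y $ j - Y (r N) $ j)) * \<tau>) \<longlonglongrightarrow> \<tau> * 0 * \<tau>"
      by (intro tendsto_intros) simp
    have "(\<lambda>N. \<delta> * \<delta> * K / real (Suc N)) \<longlonglongrightarrow> 0"
      using tendsto_mult_right_zero[OF LIMSEQ_inverse_real_of_nat, of "\<delta> * \<delta> * K"]
      by (simp add: divide_inverse)
    from LIMSEQ_subseq_LIMSEQ[OF this r]
    have 2: "(\<lambda>N. \<delta> * \<delta> * K / real (Suc (r N))) \<longlonglongrightarrow> 0" by (simp add: o_def)
    have "cmod (?e y - ?e x0) \<le> \<tau> * 0 * \<tau> + 0"
      by (rule LIMSEQ_le_const[OF tendsto_add[OF 1 2]]) (intro exI[of _ 0] allI impI bound)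
    thus ?thesis by simp
  qed
  have "?G y = ?G x0"
  proof (rule ident)
    show "network_matrix n (set es) (?G y)"
      using box_adm[OF ybox] by (simp add: network_matrix_iff consistent_param_mat adm)
    have "frobenius_norm (?G y - ?G x0) \<le> sum_norm (?G y - ?G x0)" by (rule frobenius_le_sum_norm)
    also have "\<dots> \<le> real m * \<rho>" using G_diff[OF x0c yc] box_sum[OF ybox] by simp
    finally show "frobenius_norm (?G y - ?G x0) < \<epsilon>" using \<rho>\<epsilon> by simp
    have "measurement_mat n cs * T y * excitation_mat n bs = measurement_mat n cs * T x0 * excitation_mat n bs"
      unfolding measurement_excitation[OF T[OF box_adm[OF ybox]] bs cs]
        measurement_excitation[OF T[OF x0] bs cs]
      by (rule eq_matI) (auto simp: Tyx)
    thus "measurement_mat n cs * closed_loop n (?G y) * excitation_mat n bs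
        = measurement_mat n cs * T x0 * excitation_mat n bs" by (simp add: T_def)
  qed
  hence "?G (y - x0) = 0\<^sub>m n n"
    using param_mat_diff[of y es x0 n] yc x0c by (simp add: m_def minus_r_inv_mat[of _ n n])
  hence "y - x0 = 0\<^sub>v m"
    using param_mat_eq_0_iff[OF dist es, of "y - x0"] yc x0c by (simp add: m_def)
  hence "y $ i = x0 $ i" if "i < m" for i
    using that yc x0c by (metis carrier_vecD eq_iff_diff_eq_0 index_minus_vec(1) index_zero_vec(1))
  thus False using y_neq yc x0c by (auto intro: eq_vecI)
qed

lemma poly_fun_one_minus_param_mat:
  assumes "i < n" and "j < n"
  shows "poly_fun {..<length es} (\<lambda>x. (1\<^sub>m n - param_mat n es x) $$ (i, j))"
proof -
  have "poly_fun {..<length es} (\<lambda>x. if es ! k = (j, i) then x $ k else 0)" if "k < length es" for k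
    using that by (cases "es ! k = (j, i)") (auto intro: poly_fun.intros)
  hence "poly_fun {..<length es} (\<lambda>x. (if i = j then 1 else 0)
      - (\<Sum>k<length es. if es ! k = (j, i) then x $ k else 0))"
    by (intro poly_fun_diff poly_fun_const poly_fun_sum) auto
  thus ?thesis using assms by (simp add: param_mat_def)
qed

theorem mainTheorem2:
  fixes n :: nat and E :: "(nat \<times> nat) set" and \<B> \<C> :: "nat set"
    and es :: "(nat \<times> nat) list" and bs cs :: "nat list"
  assumes "E \<subseteq> {..<n} \<times> {..<n}" and "\<B> \<subseteq> {..<n}" and "\<C> \<subseteq> {..<n}"
    and "distinct es" and "set es = E"
    and "distinct bs" and "set bs = \<B>"
    and "distinct cs" and "set cs = \<C>"
  defines "case_i \<equiv>
      almost_all n es (\<lambda>x. mat_rank (K_mat n es bs cs x) = card E) \<and>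
      generically_locally_identifiable n E es bs cs"
    and "case_ii \<equiv>
      almost_no n es (\<lambda>x. mat_rank (K_mat n es bs cs x) = card E) \<and>
      generically_locally_non_identifiable n E es bs cs"
  shows "(case_i \<or> case_ii) \<and> \<not> (case_i \<and> case_ii)
    \<and> (\<forall>x\<in>admissible n es.
         mat_rank (K_mat n es bs cs x) = card E \<longleftrightarrow>
         (\<forall>\<Delta>. consistent n E \<Delta> \<longrightarrow>
            measurement_mat n cs * closed_loop n (param_mat n es x) * \<Delta> *
              closed_loop n (param_mat n es x) * excitation_mat n bs
              = 0\<^sub>m (length cs) (length bs) \<longrightarrow>
            \<Delta> = 0\<^sub>m n n))"
proof -
  define m where "m = length es"
  have dist: "distinct es" and es: "set es \<subseteq> {..<n} \<times> {..<n}"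
    and bs: "set bs \<subseteq> {..<n}" and cs: "set cs \<subseteq> {..<n}" and E: "E = set es"
    using assms by auto
  have cardE: "card E = m" using dist by (simp add: E m_def distinct_card)
  define T where "T x = closed_loop n (param_mat n es x)" for x
  define Y where
    "Y x w = measurement_mat n cs * (T x * param_mat n es w * T x) * excitation_mat n bs" for x w
  have adm: "x \<in> admissible n es \<longleftrightarrow> x \<in> carrier_vec m \<and> det (1\<^sub>m n - param_mat n es x) \<noteq> 0" for x
    by (auto simp: admissible_def m_def)
  have T: "T x \<in> carrier_mat n n" if "x \<in> admissible n es" for x
    unfolding T_def using that by (intro closed_loop) (auto simp: adm)
  have rank_iff: "mat_rank (K_mat n es bs cs x) = card E \<longleftrightarrow>
      (\<forall>w\<in>carrier_vec m. Y x w = 0\<^sub>m (length cs) (length bs) \<longrightarrow> w = 0\<^sub>v m)"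
    if "x \<in> admissible n es" for x
    using K_mat_full_rank_iff[OF that es bs cs] by (simp add: cardE m_def Y_def T_def)

  \<comment> \<open>The rank condition as injectivity on consistent matrices\<close>
  have injectivity: "mat_rank (K_mat n es bs cs x) = card E \<longleftrightarrow>
      (\<forall>\<Delta>. consistent n E \<Delta> \<longrightarrow>
        measurement_mat n cs * T x * \<Delta> * T x * excitation_mat n bs = 0\<^sub>m (length cs) (length bs) \<longrightarrow>
        \<Delta> = 0\<^sub>m n n)" if x: "x \<in> admissible n es" for x
  proof -
    have Y: "measurement_mat n cs * T x * \<Delta> * T x * excitation_mat n bs = Y x w"
      if "\<Delta> = param_mat n es w" for \<Delta> w
    proof -
      note M = measurement_mat_carrier[of n cs] and Tx = T[OF x] and G = param_mat_carrier[of n es w]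
      have "measurement_mat n cs * T x * \<Delta> * T x = measurement_mat n cs * (T x * \<Delta>) * T x"
        unfolding that by (simp only: assoc_mult_mat[OF M Tx G])
      also have "\<dots> = measurement_mat n cs * (T x * \<Delta> * T x)"
        unfolding that by (intro assoc_mult_mat[OF M _ Tx] mult_carrier_mat[OF Tx G])
      finally show ?thesis by (simp add: Y_def that)
    qed
    show ?thesis
      unfolding rank_iff[OF x] unfolding E
    proof (intro iffI allI ballI impI)
      fix \<Delta> assume *: "\<forall>w\<in>carrier_vec m. Y x w = 0\<^sub>m (length cs) (length bs) \<longrightarrow> w = 0\<^sub>v m"
        and "consistent n (set es) \<Delta>"
        and 0: "measurement_mat n cs * T x * \<Delta> * T x * excitation_mat n bs = 0\<^sub>m (length cs) (length bs)"
      then obtain w where w: "w \<in> carrier_vec m" "\<Delta> = param_mat n es w"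
        using consistent_imp_param_mat[OF dist es] by (auto simp: m_def)
      hence "w = 0\<^sub>v m" using * 0 Y[OF w(2)] by simp
      thus "\<Delta> = 0\<^sub>m n n" using param_mat_eq_0_iff[OF dist es] w by (simp add: m_def)
    next
      fix w assume *: "\<forall>\<Delta>. consistent n (set es) \<Delta> \<longrightarrow>
          measurement_mat n cs * T x * \<Delta> * T x * excitation_mat n bs = 0\<^sub>m (length cs) (length bs) \<longrightarrow>
          \<Delta> = 0\<^sub>m n n"
        and w: "w \<in> carrier_vec m" and 0: "Y x w = 0\<^sub>m (length cs) (length bs)"
      hence "param_mat n es w = 0\<^sub>m n n" using consistent_param_mat Y[OF refl] by simp
      thus "w = 0\<^sub>v m" using param_mat_eq_0_iff[OF dist es] w by (simp add: m_def)
    qed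
  qed

  \<comment> \<open>Polynomiality of determinant and adjugate; the two cases exclude each
    other\<close>
  let ?D = "\<lambda>x. det (1\<^sub>m n - param_mat n es x)" and ?adj = "\<lambda>x. adj_mat (1\<^sub>m n - param_mat n es x)"
  have polyD: "poly_fun {..<m} ?D"
    unfolding m_def by (intro poly_fun_det poly_fun_one_minus_param_mat) (auto simp: minus_carrier_mat)
  have poly_adj: "poly_fun {..<m} (\<lambda>x. ?adj x $$ (i, j))" if "i < n" "j < n" for i j
    unfolding m_def using that
    by (intro poly_fun_adj_mat poly_fun_one_minus_param_mat) (auto simp: minus_carrier_mat)

  have not_both: "\<not> (case_i \<and> case_ii)"
  proof
    assume "case_i \<and> case_ii"
    then obtain S S' where S: "lower_dimensional m S" "lower_dimensional m S'"
      and "\<forall>x\<in>admissible n es - S. mat_rank (K_mat n es bs cs x) = card E"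
      and "\<forall>x\<in>admissible n es - S'. mat_rank (K_mat n es bs cs x) \<noteq> card E"
      unfolding case_i_def case_ii_def almost_all_def almost_no_def m_def by blast
    hence sub: "admissible n es \<subseteq> S \<union> S'" by blast
    \<comment> \<open>At x = 0 the network is empty and the determinant is 1, so the determinant is
      not the zero polynomial.\<close>
    have "param_mat n es (0\<^sub>v m) = 0\<^sub>m n n" using param_mat_eq_0_iff[OF dist es] by (simp add: m_def)
    moreover have "1\<^sub>m n - 0\<^sub>m n n = (1\<^sub>m n :: complex mat)" by (auto intro!: eq_matI)
    ultimately have "?D (0\<^sub>v m) \<noteq> 0" by simp
    from lower_dimensional_misses_nonzero[OF lower_dimensional_Un[OF S] polyD _ this]
    obtain z where "z \<in> carrier_vec m - (S \<union> S')" "?D z \<noteq> 0" by auto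
    thus False using sub by (auto simp: adm)
  qed

  \<comment> \<open>One of the two cases holds\<close>
  define I where "I = {..<length cs} \<times> {..<length bs}"
  \<comment> \<open>The entries of \<open>K_mat\<close> times the squared determinant, with rows
    indexed by pairs of a measured and an excited node.\<close>
  define A where "A i k x = ?adj x $$ (cs ! fst i, snd (es ! k)) * ?adj x $$ (fst (es ! k), bs ! snd i)"
    for i :: "nat \<times> nat" and k and x :: "complex vec"
  have polyA: "poly_fun {..<m} (A i k)" if "i \<in> I" "k < m" for i k
    unfolding A_def using that edge_nodes_less[OF es, of k]
    by (intro poly_fun_mult poly_adj) (auto simp: I_def m_def intro: nth_less_bound[OF cs] nth_less_bound[OF bs])
  have A_sum: "(\<Sum>k<m. A i k x * w $ k) = ?D x * ?D x * Y x w $$ i"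
    if x: "x \<in> admissible n es" and i: "i \<in> I" for x w i
  proof -
    obtain a b where ab: "i = (a, b)" "a < length cs" "b < length bs" using i by (auto simp: I_def)
    note can = nth_less_bound[OF cs ab(2)] and bbn = nth_less_bound[OF bs ab(3)]
    have adj: "?adj x = ?D x \<cdot>\<^sub>m T x"
      unfolding T_def using x by (intro adj_mat_closed_loop) (auto simp: adm)
    have "(\<Sum>k<m. A i k x * w $ k)
        = (\<Sum>k<m. ?D x * ?D x * (T x $$ (cs ! a, snd (es ! k)) * T x $$ (fst (es ! k), bs ! b) * w $ k))"
      using T[OF x] can bbn edge_nodes_less[OF es]
      by (intro sum.cong) (auto simp: A_def adj ab(1) m_def)
    also have "\<dots> = ?D x * ?D x * (T x * param_mat n es w * T x) $$ (cs ! a, bs ! b)"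
      by (simp only: mult_param_mat_mult_entry[OF es T[OF x] T[OF x] can bbn] sum_distrib_left m_def)
    also have "(T x * param_mat n es w * T x) $$ (cs ! a, bs ! b) = Y x w $$ i"
      unfolding Y_def measurement_excitation[OF mult_carrier_mat[OF mult_carrier_mat[OF
            T[OF x] param_mat_carrier] T[OF x]] bs cs] using ab by simp
    finally show ?thesis .
  qed
  have Y_eq_0: "Y x w = 0\<^sub>m (length cs) (length bs)" if "\<And>i. i \<in> I \<Longrightarrow> Y x w $$ i = 0" for x w
    using that measurement_mat_carrier[of n cs] excitation_mat_carrier[of n bs]
    by (intro eq_matI) (auto simp: Y_def I_def simp del: index_mult_mat(1))

  have "case_i \<or> case_ii"
  proof (rule poly_fun_kernel_or_left_inverse[of I m m A])
    show "finite I" by (simp add: I_def)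
    show "poly_fun {..<m} (A i j)" if "i \<in> I" "j < m" for i j using that by (rule polyA)
  next
    fix v :: "nat \<Rightarrow> complex vec \<Rightarrow> complex"
    assume v: "\<And>j. j < m \<Longrightarrow> poly_fun {..<m} (v j)"
      and nz: "\<exists>j<m. \<exists>x\<in>carrier_vec m. v j x \<noteq> 0"
      and ker: "\<And>x i. x \<in> carrier_vec m \<Longrightarrow> i \<in> I \<Longrightarrow> (\<Sum>j<m. A i j x * v j x) = 0"
    obtain j0 x1 where j0: "j0 < m" "x1 \<in> carrier_vec m" "v j0 x1 \<noteq> 0" using nz by blast
    \<comment> \<open>One coordinate that is not identically zero is enough: off \<open>S\<close>,
      the kernel vector \<open>V x\<close> is nonzero.\<close>
    define S where "S = {x \<in> carrier_vec m. v j0 x = 0}"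
    have S: "lower_dimensional m S"
      unfolding S_def by (rule lower_dimensional_zero_set[OF v[OF j0(1)] j0(2,3)])
    define V where "V x = vec (length es) (\<lambda>j. v j x)" for x
    have YV: "Y x (V x) = 0\<^sub>m (length cs) (length bs)" if x: "x \<in> admissible n es" for x
    proof (rule Y_eq_0)
      fix i assume i: "i \<in> I"
      have "?D x * ?D x * Y x (V x) $$ i = 0"
        using A_sum[OF x i, of "V x"] ker[OF _ i] x by (simp add: V_def m_def adm)
      thus "Y x (V x) $$ i = 0" using x by (simp add: adm)
    qed
    have "mat_rank (K_mat n es bs cs x) \<noteq> card E" if x: "x \<in> admissible n es - S" for x
    proof
      assume "mat_rank (K_mat n es bs cs x) = card E"
      hence "V x = 0\<^sub>v m" using rank_iff[of x] YV[of x] x by (auto simp: V_def m_def)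
      hence "V x $ j0 = 0" using j0 by simp
      thus False using x j0 by (auto simp: V_def S_def adm m_def)
    qed
    moreover have "\<not> locally_identifiable_at n E bs cs (param_mat n es x)"
      if x: "x \<in> admissible n es - S" for x
      unfolding E
    \<comment> \<open>The kernel identity \<open>YV\<close> holds at every admissible point,
      including points of \<open>S\<close> that the box around \<open>x\<close> may contain.\<close>
    proof (rule not_locally_identifiable_if_kernel_field[OF _ dist es bs cs])
      show "v j0 x \<noteq> 0" using x by (auto simp: S_def adm)
    qed (use x v j0 polyD YV in \<open>auto simp: m_def Y_def T_def V_def\<close>)
    ultimately show ?thesis
      using S unfolding case_ii_def almost_no_def generically_locally_non_identifiable_def m_def
      by blast
  next
    fix g :: "complex vec \<Rightarrow> complex" and u :: "nat \<Rightarrow> nat \<times> nat \<Rightarrow> complex vec \<Rightarrow> complex"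
    assume g: "poly_fun {..<m} g" and nz: "\<exists>x\<in>carrier_vec m. g x \<noteq> 0"
      and u: "\<And>x k j. x \<in> carrier_vec m \<Longrightarrow> k < m \<Longrightarrow> j < m \<Longrightarrow>
        (\<Sum>i\<in>I. u k i x * A i j x) = (if j = k then g x else 0)"
    obtain x1 where x1: "x1 \<in> carrier_vec m" "g x1 \<noteq> 0" using nz by blast
    define S where "S = {x \<in> carrier_vec m. g x = 0}"
    have S: "lower_dimensional m S" unfolding S_def by (rule lower_dimensional_zero_set[OF g x1])
    \<comment> \<open>\<open>u\<close> inverts \<open>A\<close>, so the squared determinant moves
      into the coefficients when \<open>A\<close> is replaced by the response
      \<open>Y\<close>.\<close>
    define U where "U x k i = u k i x * (?D x * ?D x) / g x" for x k i
    have inv: "w $ k = (\<Sum>i\<in>I. U x k i * Y x w $$ i)"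
      if x: "x \<in> admissible n es - S" and k: "k < m" for x w k
    proof -
      have xc: "x \<in> carrier_vec m" and g0: "g x \<noteq> 0" using x by (auto simp: adm S_def)
      have "g x * w $ k = (\<Sum>j<m. if j = k then g x * w $ j else 0)" using k by simp
      also have "\<dots> = (\<Sum>j<m. (\<Sum>i\<in>I. u k i x * A i j x) * w $ j)"
        using u[OF xc k] by (intro sum.cong) auto
      also have "\<dots> = (\<Sum>i\<in>I. u k i x * (\<Sum>j<m. A i j x * w $ j))"
        unfolding sum_distrib_right sum_distrib_left by (subst sum.swap) (simp add: mult.assoc)
      also have "\<dots> = (\<Sum>i\<in>I. u k i x * (?D x * ?D x * Y x w $$ i))"
        using x by (intro sum.cong) (auto simp: A_sum)
      finally have "w $ k = (\<Sum>i\<in>I. u k i x * (?D x * ?D x * Y x w $$ i)) / g x"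
        using g0 by (simp add: field_simps)
      thus ?thesis by (simp add: U_def sum_divide_distrib mult.assoc)
    qed
    have "mat_rank (K_mat n es bs cs x) = card E" if x: "x \<in> admissible n es - S" for x
      unfolding rank_iff[OF DiffD1[OF x]]
    proof (intro ballI impI)
      fix w assume w: "w \<in> carrier_vec m" and 0: "Y x w = 0\<^sub>m (length cs) (length bs)"
      show "w = 0\<^sub>v m"
      proof (rule eq_vecI)
        fix k assume "k < dim_vec (0\<^sub>v m :: complex vec)"
        hence k: "k < m" by simp
        have "w $ k = 0" unfolding inv[OF x k] 0 by (intro sum.neutral) (auto simp: I_def)
        thus "w $ k = 0\<^sub>v m $ k" using k by simp
      qed (use w in auto)
    qed
    moreover have "locally_identifiable_at n E bs cs (param_mat n es x)"
      if x: "x \<in> admissible n es - S" for x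
      unfolding E
    proof (rule locally_identifiable_if_left_inverse[OF DiffD1[OF x] dist es bs cs])
      fix w k assume "k < length es"
      thus "w $ k = (\<Sum>a<length cs. \<Sum>b<length bs. U x k (a, b) *
          (measurement_mat n cs * (closed_loop n (param_mat n es x) * param_mat n es w *
            closed_loop n (param_mat n es x)) * excitation_mat n bs) $$ (a, b))"
        using inv[OF x, of k w] by (simp add: I_def sum.cartesian_product Y_def T_def m_def case_prod_unfold)
    qed
    ultimately show ?thesis
      using S unfolding case_i_def almost_all_def generically_locally_identifiable_def m_def
      by blast
  qed
  with not_both injectivity show ?thesis unfolding T_def by blast
qed

end
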